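(* Let $C>0$, $p>1$ (with $p=\infty$ allowed), and $0<\varepsilon<1$. Set $$N=(6/\varepsilon)^{\max\{2,\,p/(p-1)\}}\qquad\text{and}\qquad \eta=4^{-N-1}(\varepsilon/320)^{p/(p-1)} .$$ Let $G$ be a $(C,\eta)$-upper $L^p$ regular weighted graph with vertex set $V$. Then there exists a partition $\mathcal{P}$ of $V$ into at most $4^N$ parts, each having weight at least $\eta\alpha_G$, such that $$d_\square\!\left(\frac{G}{\|G\|_1},\frac{G_{\mathcal{P}}}{\|G\|_1}\right)\le C\varepsilon .$$
   Context: A weighted graph $G$ is a finite graph with vertex set $V(G)$, in which each vertex $i$ has a weight $\alpha_i>0$ and each edge $ij$ (loops $i=j$ allowed) has a weight $\beta_{ij}=\beta_{ji}=\beta_{ij}(G)\in\mathbb{R}$, with $\beta_{ij}=0$ if $ij$ is not an edge. For $U\subseteq V(G)$ its weight is $\alpha_U=\sum_{i\in U}\alpha_i$, and $\alpha_G=\alpha_{V(G)}$. Put $\|G\|_1=\sum_{i,j\in V(G)}\frac{\alpha_i\alpha_j}{\alpha_G^2}|\beta_{ij}|$, assumed nonzero. For $c\in\mathbb{R}$, $cG$ is $G$ with all edge weights multiplied by $c$ (vertex weights unchanged). For nonempty $S,T\subseteq V(G)$ let $\rho_G(S,T)=\sum_{s\in S,\,t\in T}\frac{\alpha_s\alpha_t}{\alpha_S\alpha_T}\beta_{st}$. The graph $G$ is $(C,\eta)$-upper $L^p$ regular if $\alpha_i\le\eta\alpha_G$ for all $i\in V(G)$ and, whenever $V_1\cup\dots\cup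 V_m$ is a partition of $V(G)$ into disjoint sets with $\alpha_{V_i}\ge\eta\alpha_G$ for each $i$, $$\sum_{i,j=1}^m\frac{\alpha_{V_i}\alpha_{V_j}}{\alpha_G^2}\left|\frac{\rho_G(V_i,V_j)}{\|G\|_1}\right|^p\le C^p,$$ where for $p=\infty$ this is replaced by $\max_{i,j}|\rho_G(V_i,V_j)|/\|G\|_1\le C$. If $p=\infty$, $p/(p-1)$ is read as $1$. For a partition $\mathcal{P}=\{V_1,\dots,V_m\}$ of $V(G)$, $G_{\mathcal{P}}$ is the weighted graph on $V(G)$ with the same vertex weights and with edge weight $\beta_{st}(G_{\mathcal{P}})=\rho_G(V_i,V_j)$ for $s\in V_i$, $t\in V_j$. For two weighted graphs $G,G'$ on the same vertex set $V$ with the same vertex weights, $$d_\square(G,G')=\max_{S,T\subseteq V}\left|\sum_{s\in S,\,t\in T}\frac{\alpha_s\alpha_t}{\alpha_G^2}\big(\beta_{st}(G)-\beta_{st}(G')\big)\right| .$$ *)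

theory Defs
  imports "HOL-Analysis.Analysis" "HOL-Library.Disjoint_Sets"
begin

text \<open>
  Non-edges have edge weight 0, and every quantity below depends on the edges only through the
  edge weights, so no separate edge set is recorded.  The values of the two weight functions
  outside the vertex set are irrelevant.
\<close>

record 'a wgraph =
  verts :: "'a set"
  vweight :: "'a \<Rightarrow> real"
  eweight :: "'a \<Rightarrow> 'a \<Rightarrow> real"

definition weighted_graph :: "'a wgraph \<Rightarrow> bool" where
  "weighted_graph G \<longleftrightarrow>
     finite (verts G) \<and>
     (\<forall>i\<in>verts G. vweight G i > 0) \<and>
     (\<forall>i\<in>verts G. \<forall>j\<in>verts G. eweight G i j = eweight G j i)"

definition set_weight :: "'a wgraph \<Rightarrow> 'a set \<Rightarrow> real" where
  "set_weight G U = (\<Sum>i\<in>U. vweight G i)"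

definition total_weight :: "'a wgraph \<Rightarrow> real" where
  "total_weight G = set_weight G (verts G)"

definition norm1 :: "'a wgraph \<Rightarrow> real" where
  "norm1 G = (\<Sum>i\<in>verts G. \<Sum>j\<in>verts G.
     vweight G i * vweight G j / (total_weight G)\<^sup>2 * \<bar>eweight G i j\<bar>)"

definition scale_graph :: "real \<Rightarrow> 'a wgraph \<Rightarrow> 'a wgraph" where
  "scale_graph c G = G\<lparr>eweight := \<lambda>i j. c * eweight G i j\<rparr>"

definition rho :: "'a wgraph \<Rightarrow> 'a set \<Rightarrow> 'a set \<Rightarrow> real" where
  "rho G S T = (\<Sum>s\<in>S. \<Sum>t\<in>T.
     vweight G s * vweight G t / (set_weight G S * set_weight G T) * eweight G s t)"

text \<open>
  The exponent \<open>p\<close> is an extended real.  The parts of a \<^const>\<open>partition_on\<close> are nonempty, so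
  summing over the set of parts is the same as summing over their indices.
\<close>

definition upper_Lp_regular :: "ereal \<Rightarrow> real \<Rightarrow> real \<Rightarrow> 'a wgraph \<Rightarrow> bool" where
  "upper_Lp_regular p C \<eta> G \<longleftrightarrow>
     (\<forall>i\<in>verts G. vweight G i \<le> \<eta> * total_weight G) \<and>
     (\<forall>P. partition_on (verts G) P \<and> (\<forall>A\<in>P. set_weight G A \<ge> \<eta> * total_weight G) \<longrightarrow>
        (if p = \<infinity> then Max {\<bar>rho G A B\<bar> / norm1 G | A B. A \<in> P \<and> B \<in> P} \<le> C
         else (\<Sum>A\<in>P. \<Sum>B\<in>P. set_weight G A * set_weight G B / (total_weight G)\<^sup>2 *
                 \<bar>rho G A B / norm1 G\<bar> powr real_of_ereal p) \<le> C powr real_of_ereal p))"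

definition conj_exponent :: "ereal \<Rightarrow> real" where
  "conj_exponent p = (if p = \<infinity> then 1 else real_of_ereal p / (real_of_ereal p - 1))"

definition part_of :: "'a set set \<Rightarrow> 'a \<Rightarrow> 'a set" where
  "part_of P s = (THE A. A \<in> P \<and> s \<in> A)"

definition step_graph :: "'a wgraph \<Rightarrow> 'a set set \<Rightarrow> 'a wgraph" where
  "step_graph G P = G\<lparr>eweight := \<lambda>s t. rho G (part_of P s) (part_of P t)\<rparr>"

lemma part_of_eq:
  assumes "partition_on V P" "A \<in> P" "s \<in> A"
  shows "part_of P s = A"
  unfolding part_of_def
proof (rule the_equality)
  show "A \<in> P \<and> s \<in> A" using assms by simp
next
  fix B assume "B \<in> P \<and> s \<in> B"
  then show "B = A"
    using disjointD[OF partition_onD2[OF assms(1)], of B A] assms by blast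
qed

lemma eweight_step_graph:
  assumes "partition_on (verts G) P" "A \<in> P" "B \<in> P" "s \<in> A" "t \<in> B"
  shows "eweight (step_graph G P) s t = rho G A B"
  using assms by (simp add: step_graph_def part_of_eq)

text \<open>
  Only meant for graphs with the same vertices and vertex weights; these are read off from
  the first argument.
\<close>

definition cut_dist :: "'a wgraph \<Rightarrow> 'a wgraph \<Rightarrow> real" where
  "cut_dist G G' = Max {\<bar>\<Sum>s\<in>S. \<Sum>t\<in>T. vweight G s * vweight G t / (total_weight G)\<^sup>2 *
      (eweight G s t - eweight G' s t)\<bar> | S T. S \<subseteq> verts G \<and> T \<subseteq> verts G}"

end

theory Submission
  imports Defs
begin

text \<open>
  Write \<open>W\<close> for the edge weights divided by \<open>norm1 G\<close>, viewed as a function on the probability space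
  of pairs of vertices.  Passing to \<open>G\<^sub>P\<close> is taking the conditional expectation of \<open>W\<close> on the product
  partition, and upper regularity bounds its \<open>L\<^sup>p\<close> norm as long as no part is lighter than \<open>\<eta>\<close>.

  Start with the trivial partition.  While \<open>P\<close> fails, refine it by a violating pair \<open>S, T\<close>; cells
  lighter than \<open>\<eta>\<close> are first merged into another cell of the same part, which moves little weight and
  costs at most half of the discrepancy \<open>C \<epsilon>\<close>, by Hoelder's inequality.  The function
  \<open>u = 1 - E[1 | P]\<close>, with \<open>1\<close> the indicator of the adjusted rectangle, is measurable with respect to the
  refined partition, orthogonal to everything measurable with respect to \<open>P\<close>, bounded by 1, and
  satisfies \<open>\<bar>\<langle>W, u\<rangle>\<bar> \<ge> C \<epsilon> / 2\<close>.  So the functions \<open>u\<close> of successive steps are orthogonal.  In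
  \<open>\<langle>W, u\<rangle>\<close> one may replace \<open>W\<close> by its conditional expectation on the final partition, and this splits
  as \<open>g + h\<close> with \<open>h\<close> of \<open>L\<^sup>1\<close> norm at most \<open>C \<epsilon> / 6\<close> and \<open>g\<close> of squared \<open>L\<^sup>2\<close> norm at most
  \<open>N (C \<epsilon> / 6)\<^sup>2\<close> (truncation if \<open>p < 2\<close>, and \<open>h = 0\<close> otherwise).  Bessel's inequality for \<open>g\<close> then
  allows at most \<open>N\<close> steps.
\<close>

section \<open>Conditional expectation on finite weighted spaces\<close>

lemma sum_over_partition:
  assumes "finite V" "partition_on V P"
  shows "(\<Sum>x\<in>V. f x) = (\<Sum>A\<in>P. \<Sum>x\<in>A. f x)"
proof -
  have "V = \<Union>P" using partition_onD1[OF assms(2)] .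
  moreover have "\<forall>A\<in>P. finite A"
    using assms finite_elements[OF assms] partition_onD1[OF assms(2)] by (metis Sup_upper finite_subset)
  moreover have "\<forall>A\<in>P. \<forall>B\<in>P. A \<noteq> B \<longrightarrow> A \<inter> B = {}"
    using partition_onD2[OF assms(2)] by (meson disjointD)
  ultimately show ?thesis using sum.Union_disjoint[of P f] by simp
qed

lemma part_of_props:
  assumes "partition_on V P" "x \<in> V"
  shows "part_of P x \<in> P" "x \<in> part_of P x" "part_of P x \<subseteq> V"
proof -
  obtain A where A: "A \<in> P" "x \<in> A" using assms partition_onD1 by blast
  with assms(1) have "part_of P x = A" by (rule part_of_eq)
  with A show "part_of P x \<in> P" "x \<in> part_of P x" by simp_all
  then show "part_of P x \<subseteq> V" using partition_onD1[OF assms(1)] by blast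
qed

lemma sum_part_of:
  fixes \<mu> :: "'a \<Rightarrow> real"
  assumes "finite V" "partition_on V P"
  shows "(\<Sum>x\<in>V. \<mu> x * H (part_of P x)) = (\<Sum>A\<in>P. sum \<mu> A * H A)"
proof -
  have "(\<Sum>x\<in>A. \<mu> x * H (part_of P x)) = sum \<mu> A * H A" if "A \<in> P" for A
    using part_of_eq[OF assms(2) that] by (simp add: sum_distrib_right)
  then show ?thesis by (simp add: sum_over_partition[OF assms])
qed

section \<open>Product partitions of the space of pairs\<close>

definition prod_partition :: "'a set set \<Rightarrow> ('a \<times> 'a) set set" where
  "prod_partition P = (\<lambda>(A, B). A \<times> B) ` (P \<times> P)"

lemma partition_on_prod_partition:
  assumes "partition_on V P"
  shows "partition_on (V \<times> V) (prod_partition P)"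
proof (rule partition_onI)
  show "\<Union>(prod_partition P) = V \<times> V"
    using partition_onD1[OF assms] by (auto simp: prod_partition_def)
  show "{} \<notin> prod_partition P"
    using partition_onD3[OF assms] by (auto simp: prod_partition_def eq_commute[of "{}"] Times_empty)
  show "disjnt p q" if "p \<in> prod_partition P" "q \<in> prod_partition P" "p \<noteq> q" for p q
    using that disjointD[OF partition_onD2[OF assms]]
    by (auto simp: prod_partition_def disjnt_def)
qed

lemma part_of_prod_partition:
  assumes "partition_on V P" "x \<in> V" "y \<in> V"
  shows "part_of (prod_partition P) (x, y) = part_of P x \<times> part_of P y"
proof (rule part_of_eq[OF partition_on_prod_partition[OF assms(1)]])
  show "part_of P x \<times> part_of P y \<in> prod_partition P"
    using assms by (auto simp: prod_partition_def part_of_props intro!: image_eqI[where x="(part_of P x, part_of P y)"])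
qed (use assms in \<open>auto simp: part_of_props\<close>)

text \<open>Measurability with respect to the finite algebra generated by \<open>P\<close>.\<close>

definition const_on_parts :: "'b set set \<Rightarrow> ('b \<Rightarrow> real) \<Rightarrow> bool" where
  "const_on_parts P f \<longleftrightarrow> (\<forall>A\<in>P. \<forall>x\<in>A. \<forall>y\<in>A. f x = f y)"

lemma const_on_parts_diff:
  assumes "const_on_parts P f" "const_on_parts P g"
  shows "const_on_parts P (\<lambda>z. f z - g z)"
  unfolding const_on_parts_def
proof (intro ballI)
  fix A x y assume "A \<in> P" "x \<in> A" "y \<in> A"
  with assms have "f x = f y" "g x = g y" unfolding const_on_parts_def by blast+
  then show "f x - g x = f y - g y" by simp
qed

lemma const_on_parts_refine:
  assumes "const_on_parts P f" "\<forall>B\<in>Q. \<exists>A\<in>P. B \<subseteq> A"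
  shows "const_on_parts Q f"
  unfolding const_on_parts_def
proof (intro ballI)
  fix B x y assume "B \<in> Q" "x \<in> B" "y \<in> B"
  moreover obtain A where "A \<in> P" "B \<subseteq> A" using assms(2) \<open>B \<in> Q\<close> by blast
  ultimately show "f x = f y" using assms(1) unfolding const_on_parts_def by (meson subsetD)
qed

lemma refines_prod_partition:
  assumes "\<forall>B\<in>Q. \<exists>A\<in>P. B \<subseteq> A"
  shows "\<forall>B\<in>prod_partition Q. \<exists>A\<in>prod_partition P. B \<subseteq> A"
proof
  fix Z assume "Z \<in> prod_partition Q"
  then obtain B B' where "B \<in> Q" "B' \<in> Q" "Z = B \<times> B'" by (auto simp: prod_partition_def)
  moreover obtain A A' where "A \<in> P" "B \<subseteq> A" "A' \<in> P" "B' \<subseteq> A'" using calculation assms by meson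
  ultimately show "\<exists>A\<in>prod_partition P. Z \<subseteq> A"
    by (intro bexI[of _ "A \<times> A'"]) (auto simp: prod_partition_def)
qed

section \<open>Conditional expectation given a finite partition\<close>

definition cexp :: "('b \<Rightarrow> real) \<Rightarrow> 'b set set \<Rightarrow> ('b \<Rightarrow> real) \<Rightarrow> 'b \<Rightarrow> real" where
  "cexp \<nu> P f z = (\<Sum>y\<in>part_of P z. \<nu> y * f y) / sum \<nu> (part_of P z)"

locale weighted_space =
  fixes \<Omega> :: "'b set" and \<nu> :: "'b \<Rightarrow> real"
  assumes finite_space: "finite \<Omega>" and weight_pos: "x \<in> \<Omega> \<Longrightarrow> \<nu> x > 0"
begin

lemma part_weight_pos:
  assumes "partition_on \<Omega> P" "A \<in> P"
  shows "sum \<nu> A > 0"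
proof (rule sum_pos)
  have "A \<subseteq> \<Omega>" using assms partition_onD1 by blast
  then show "finite A" "\<And>x. x \<in> A \<Longrightarrow> 0 < \<nu> x"
    using finite_space weight_pos by (auto intro: finite_subset)
  show "A \<noteq> {}" using assms partition_onD3 by blast
qed

lemma const_on_parts_cexp:
  assumes "partition_on \<Omega> P"
  shows "const_on_parts P (cexp \<nu> P f)"
  using part_of_eq[OF assms] by (auto simp: const_on_parts_def cexp_def)

lemma sum_cexp_part:
  assumes "partition_on \<Omega> P" "A \<in> P"
  shows "(\<Sum>z\<in>A. \<nu> z * cexp \<nu> P f z) = (\<Sum>z\<in>A. \<nu> z * f z)"
proof -
  have "(\<Sum>z\<in>A. \<nu> z * cexp \<nu> P f z) = (\<Sum>z\<in>A. \<nu> z * ((\<Sum>y\<in>A. \<nu> y * f y) / sum \<nu> A))"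
    using part_of_eq[OF assms] by (intro sum.cong) (auto simp: cexp_def)
  also have "\<dots> = (\<Sum>z\<in>A. \<nu> z * f z)"
    using part_weight_pos[OF assms] by (simp flip: sum_distrib_right sum_divide_distrib)
  finally show ?thesis .
qed

text \<open>The defining property of conditional expectation: on each part \<open>F\<close> is a
  constant that can be pulled out, and averaging preserves the integral over the part.\<close>

lemma sum_cexp_const_on_parts:
  assumes "partition_on \<Omega> P" "const_on_parts P F"
  shows "(\<Sum>z\<in>\<Omega>. \<nu> z * cexp \<nu> P f z * F z) = (\<Sum>z\<in>\<Omega>. \<nu> z * f z * F z)"
proof -
  have "(\<Sum>z\<in>A. \<nu> z * cexp \<nu> P f z * F z) = (\<Sum>z\<in>A. \<nu> z * f z * F z)" if A: "A \<in> P" for A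
  proof -
    have "A \<noteq> {}" using A partition_onD3[OF assms(1)] by blast
    then obtain a where "a \<in> A" by blast
    then have F: "F z = F a" if "z \<in> A" for z
      using A that assms(2) unfolding const_on_parts_def by blast
    have "(\<Sum>z\<in>A. \<nu> z * h z * F z) = (\<Sum>z\<in>A. \<nu> z * h z) * F a" for h
      unfolding sum_distrib_right using F by (intro sum.cong) auto
    then show ?thesis using sum_cexp_part[OF assms(1) A, of f] by simp
  qed
  then show ?thesis by (simp add: sum_over_partition[OF finite_space assms(1)])
qed

text \<open>Conditional expectation is self-adjoint: both sides equal the inner product of the two
  averaged functions.\<close>

lemma sum_cexp_commute:
  assumes "partition_on \<Omega> P"
  shows "(\<Sum>z\<in>\<Omega>. \<nu> z * cexp \<nu> P f z * g z) = (\<Sum>z\<in>\<Omega>. \<nu> z * f z * cexp \<nu> P g z)"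
proof -
  have "(\<Sum>z\<in>\<Omega>. \<nu> z * cexp \<nu> P f z * g z) = (\<Sum>z\<in>\<Omega>. \<nu> z * g z * cexp \<nu> P f z)"
    by (intro sum.cong refl) simp
  also have "\<dots> = (\<Sum>z\<in>\<Omega>. \<nu> z * cexp \<nu> P g z * cexp \<nu> P f z)"
    using sum_cexp_const_on_parts[OF assms const_on_parts_cexp[OF assms]] by metis
  also have "\<dots> = (\<Sum>z\<in>\<Omega>. \<nu> z * cexp \<nu> P f z * cexp \<nu> P g z)"
    by (intro sum.cong refl) simp
  also have "\<dots> = (\<Sum>z\<in>\<Omega>. \<nu> z * f z * cexp \<nu> P g z)"
    using sum_cexp_const_on_parts[OF assms const_on_parts_cexp[OF assms]] by metis
  finally show ?thesis .
qed

lemma cexp_bounds: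
  assumes "partition_on \<Omega> P" "z \<in> \<Omega>" "\<And>y. y \<in> \<Omega> \<Longrightarrow> 0 \<le> f y \<and> f y \<le> 1"
  shows "0 \<le> cexp \<nu> P f z" "cexp \<nu> P f z \<le> 1"
proof -
  note A = part_of_props[OF assms(1,2)]
  have \<nu>: "0 \<le> \<nu> y" if "y \<in> \<Omega>" for y using weight_pos[OF that] by simp
  show "0 \<le> cexp \<nu> P f z"
    using A(3) \<nu> assms(3) unfolding cexp_def by (intro divide_nonneg_nonneg sum_nonneg) auto
  have "(\<Sum>y\<in>part_of P z. \<nu> y * f y) \<le> sum \<nu> (part_of P z)"
    using A(3) \<nu> assms(3) by (intro sum_mono) (auto intro: mult_left_le)
  then show "cexp \<nu> P f z \<le> 1"
    using part_weight_pos[OF assms(1) A(1)] by (simp add: cexp_def)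
qed

text \<open>Expand the nonnegative squared norm of \<open>g - s\<close>, where \<open>s\<close>
  combines the \<open>u i\<close> with coefficients \<open>c i\<close>. The \<open>u i\<close> have
  norm at most 1 and need not be normalised, so \<open>s\<close> may differ from the projection of
  \<open>g\<close>. Its squared norm is still at most the sum of the \<open>(c i)\<^sup>2\<close>,
  and that sum is the inner product of \<open>g\<close> and \<open>s\<close>.\<close>

lemma bessel_inequality:
  fixes u :: "nat \<Rightarrow> 'b \<Rightarrow> real"
  assumes orth: "\<And>i j. i < n \<Longrightarrow> j < n \<Longrightarrow> i \<noteq> j \<Longrightarrow> (\<Sum>z\<in>\<Omega>. \<nu> z * u i z * u j z) = 0"
    and norm: "\<And>i. i < n \<Longrightarrow> (\<Sum>z\<in>\<Omega>. \<nu> z * (u i z)\<^sup>2) \<le> 1"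
  shows "(\<Sum>i<n. (\<Sum>z\<in>\<Omega>. \<nu> z * g z * u i z)\<^sup>2) \<le> (\<Sum>z\<in>\<Omega>. \<nu> z * (g z)\<^sup>2)"
proof -
  define c where "c i = (\<Sum>z\<in>\<Omega>. \<nu> z * g z * u i z)" for i
  define s where "s z = (\<Sum>i<n. c i * u i z)" for z
  have gs: "(\<Sum>z\<in>\<Omega>. \<nu> z * g z * s z) = (\<Sum>i<n. (c i)\<^sup>2)"
  proof -
    have "(\<Sum>z\<in>\<Omega>. \<nu> z * g z * s z) = (\<Sum>z\<in>\<Omega>. \<Sum>i<n. c i * (\<nu> z * g z * u i z))"
      by (simp add: s_def sum_distrib_left mult_ac)
    also have "\<dots> = (\<Sum>i<n. c i * c i)"
      by (subst sum.swap) (simp add: c_def sum_distrib_left)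
    finally show ?thesis by (simp add: power2_eq_square)
  qed
  have us: "(\<Sum>z\<in>\<Omega>. \<nu> z * u i z * s z) = c i * (\<Sum>z\<in>\<Omega>. \<nu> z * (u i z)\<^sup>2)" if i: "i < n" for i
  proof -
    have "(\<Sum>z\<in>\<Omega>. \<nu> z * u i z * s z) = (\<Sum>z\<in>\<Omega>. \<Sum>j<n. c j * (\<nu> z * u i z * u j z))"
      by (simp add: s_def sum_distrib_left mult_ac)
    also have "\<dots> = (\<Sum>j<n. c j * (\<Sum>z\<in>\<Omega>. \<nu> z * u i z * u j z))"
      by (subst sum.swap) (simp add: sum_distrib_left)
    also have "\<dots> = (\<Sum>j<n. if j = i then c i * (\<Sum>z\<in>\<Omega>. \<nu> z * u i z * u i z) else 0)"
      using orth i by (intro sum.cong) auto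
    also have "\<dots> = c i * (\<Sum>z\<in>\<Omega>. \<nu> z * (u i z)\<^sup>2)"
      using i by (simp add: power2_eq_square mult_ac)
    finally show ?thesis .
  qed
  have ss: "(\<Sum>z\<in>\<Omega>. \<nu> z * (s z)\<^sup>2) \<le> (\<Sum>i<n. (c i)\<^sup>2)"
  proof -
    have "(\<Sum>z\<in>\<Omega>. \<nu> z * (s z)\<^sup>2) = (\<Sum>z\<in>\<Omega>. \<nu> z * s z * (\<Sum>i<n. c i * u i z))"
      by (simp add: s_def power2_eq_square mult_ac)
    also have "\<dots> = (\<Sum>z\<in>\<Omega>. \<Sum>i<n. c i * (\<nu> z * u i z * s z))"
      by (simp add: sum_distrib_left mult_ac)
    also have "\<dots> = (\<Sum>i<n. c i * (\<Sum>z\<in>\<Omega>. \<nu> z * u i z * s z))"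
      by (subst sum.swap) (simp add: sum_distrib_left)
    also have "\<dots> = (\<Sum>i<n. (c i)\<^sup>2 * (\<Sum>z\<in>\<Omega>. \<nu> z * (u i z)\<^sup>2))"
      by (intro sum.cong) (auto simp: us power2_eq_square)
    also have "\<dots> \<le> (\<Sum>i<n. (c i)\<^sup>2)"
      using norm by (intro sum_mono) (auto intro: mult_left_le)
    finally show ?thesis .
  qed
  have "0 \<le> (\<Sum>z\<in>\<Omega>. \<nu> z * (g z - s z)\<^sup>2)"
    using weight_pos by (intro sum_nonneg mult_nonneg_nonneg) (auto intro: less_imp_le)
  also have "\<dots> = (\<Sum>z\<in>\<Omega>. \<nu> z * (g z)\<^sup>2) - 2 * (\<Sum>z\<in>\<Omega>. \<nu> z * g z * s z) + (\<Sum>z\<in>\<Omega>. \<nu> z * (s z)\<^sup>2)"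
    by (simp add: power2_diff algebra_simps sum.distrib sum_subtractf sum_distrib_left)
  finally show ?thesis using gs ss by (simp add: c_def)
qed

end

section \<open>Rectangles with a light side\<close>

definition kint :: "('a \<Rightarrow> real) \<Rightarrow> ('a \<Rightarrow> 'a \<Rightarrow> real) \<Rightarrow> 'a set \<Rightarrow> 'a set \<Rightarrow> real" where
  "kint \<mu> W S T = (\<Sum>s\<in>S. \<Sum>t\<in>T. \<mu> s * \<mu> t * W s t)"

text \<open>The kernel counterpart of \<open>step_graph\<close>, for vertex weights \<mu> and kernel
  \<open>W\<close>.\<close>

definition stepk :: "('a \<Rightarrow> real) \<Rightarrow> 'a set set \<Rightarrow> ('a \<Rightarrow> 'a \<Rightarrow> real) \<Rightarrow> 'a \<Rightarrow> 'a \<Rightarrow> real" where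
  "stepk \<mu> P W s t =
     kint \<mu> W (part_of P s) (part_of P t) / (sum \<mu> (part_of P s) * sum \<mu> (part_of P t))"

lemma kint_Un_left:
  assumes "finite S" "finite S'" "S \<inter> S' = {}"
  shows "kint \<mu> W (S \<union> S') T = kint \<mu> W S T + kint \<mu> W S' T"
  using assms by (simp add: kint_def sum.union_disjoint)

lemma kint_Un_right:
  assumes "finite T" "finite T'" "T \<inter> T' = {}"
  shows "kint \<mu> W S (T \<union> T') = kint \<mu> W S T + kint \<mu> W S T'"
  using assms by (simp add: kint_def sum.union_disjoint sum.distrib)

text \<open>The pair \<delta>, \<kappa> is what is kept of the L^p condition: once averaged over
  parts of weight at least \<eta>, the kernel has integral at most \<kappa> over rectangles of
  weight at most \<delta>. Nothing of the kind is assumed for \<open>W\<close> itself. The slack in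
  \<open>8 * \<eta> \<le> \<delta>\<close> and \<open>\<delta> \<le> 1/8\<close> leaves room to
  enlarge light sets by a few multiples of \<eta>.\<close>

locale regular_kernel =
  fixes V :: "'a set" and \<mu> :: "'a \<Rightarrow> real" and W :: "'a \<Rightarrow> 'a \<Rightarrow> real" and \<eta> \<delta> \<kappa> :: real
  assumes finite_V: "finite V"
    and weight_pos: "x \<in> V \<Longrightarrow> \<mu> x > 0"
    and total_weight_1: "sum \<mu> V = 1"
    and symmetric: "x \<in> V \<Longrightarrow> y \<in> V \<Longrightarrow> W x y = W y x"
    and small_weights: "x \<in> V \<Longrightarrow> \<mu> x \<le> \<eta>"
    and \<eta>_pos: "\<eta> > 0" and \<eta>_le: "8 * \<eta> \<le> \<delta>" and \<delta>_le: "\<delta> \<le> 1/8"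
    and stepk_bound: "partition_on V P \<Longrightarrow> (\<forall>A\<in>P. \<eta> \<le> sum \<mu> A) \<Longrightarrow> U \<subseteq> V \<Longrightarrow> X \<subseteq> V \<Longrightarrow>
      sum \<mu> U * sum \<mu> X \<le> \<delta> \<Longrightarrow> \<bar>kint \<mu> (stepk \<mu> P W) U X\<bar> \<le> \<kappa>"
begin

section \<open>Arithmetic of weights and of the bilinear form \<open>b\<close>\<close>

abbreviation b where "b \<equiv> kint \<mu> W"

lemma finite_sub: "A \<subseteq> V \<Longrightarrow> finite A"
  using finite_V by (rule rev_finite_subset)

lemma weight_nonneg: "A \<subseteq> V \<Longrightarrow> 0 \<le> sum \<mu> A"
  using weight_pos by (intro sum_nonneg) (auto intro: less_imp_le)

lemma weight_mono: "A \<subseteq> B \<Longrightarrow> B \<subseteq> V \<Longrightarrow> sum \<mu> A \<le> sum \<mu> B"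
  using weight_pos finite_sub by (intro sum_mono2) (auto intro: less_imp_le)

lemma weight_le_1: "A \<subseteq> V \<Longrightarrow> sum \<mu> A \<le> 1"
  using weight_mono[of A V] total_weight_1 by simp

lemma weight_Un_disjoint:
  "A \<subseteq> V \<Longrightarrow> B \<subseteq> V \<Longrightarrow> A \<inter> B = {} \<Longrightarrow> sum \<mu> (A \<union> B) = sum \<mu> A + sum \<mu> B"
  using finite_sub by (intro sum.union_disjoint) auto

lemma weight_Un_le: "A \<subseteq> V \<Longrightarrow> B \<subseteq> V \<Longrightarrow> sum \<mu> (A \<union> B) \<le> sum \<mu> A + sum \<mu> B"
  using sum.union_inter[of A B \<mu>] weight_nonneg[of "A \<inter> B"] finite_sub by fastforce

lemma weight_Diff: "A \<subseteq> B \<Longrightarrow> B \<subseteq> V \<Longrightarrow> sum \<mu> (B - A) = sum \<mu> B - sum \<mu> A"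
  using finite_sub by (intro sum_diff) auto

lemma b_commute:
  assumes "S \<subseteq> V" "T \<subseteq> V"
  shows "b S T = b T S"
proof -
  have "b S T = (\<Sum>t\<in>T. \<Sum>s\<in>S. \<mu> s * \<mu> t * W s t)"
    unfolding kint_def by (rule sum.swap)
  also have "\<dots> = b T S"
    unfolding kint_def using assms symmetric
    by (intro sum.cong refl) (simp add: subset_iff mult.commute)
  finally show ?thesis .
qed

lemma b_Un_left:
  "S \<subseteq> V \<Longrightarrow> S' \<subseteq> V \<Longrightarrow> S \<inter> S' = {} \<Longrightarrow> b (S \<union> S') T = b S T + b S' T"
  using finite_sub by (intro kint_Un_left) auto

lemma b_Un_right:
  "T \<subseteq> V \<Longrightarrow> T' \<subseteq> V \<Longrightarrow> T \<inter> T' = {} \<Longrightarrow> b S (T \<union> T') = b S T + b S T'"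
  using finite_sub by (intro kint_Un_right) auto

lemma part_weight_pos: "A \<subseteq> V \<Longrightarrow> A \<noteq> {} \<Longrightarrow> sum \<mu> A > 0"
  using weight_pos finite_sub by (intro sum_pos) auto

text \<open>Averaging preserves the integral over a product of whole parts. This is how
  \<open>stepk_bound\<close> says something about \<open>W\<close>.\<close>

lemma kint_stepk_parts:
  assumes "partition_on V P" "A \<in> P" "B \<in> P"
  shows "kint \<mu> (stepk \<mu> P W) A B = b A B"
proof -
  have "A \<subseteq> V" "A \<noteq> {}" "B \<subseteq> V" "B \<noteq> {}"
    using assms partition_onD1[OF assms(1)] partition_onD3[OF assms(1)] by blast+
  then have pos: "sum \<mu> A > 0" "sum \<mu> B > 0" using part_weight_pos by simp_all
  define K where "K = b A B / (sum \<mu> A * sum \<mu> B)"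
  have "kint \<mu> (stepk \<mu> P W) A B = (\<Sum>s\<in>A. \<Sum>t\<in>B. \<mu> s * \<mu> t * K)"
    unfolding kint_def[of _ "stepk \<mu> P W"] using part_of_eq[OF assms(1)] assms
    by (intro sum.cong refl) (simp add: stepk_def K_def)
  also have "\<dots> = (sum \<mu> A * sum \<mu> B) * K"
    unfolding sum_product by (simp only: sum_distrib_right)
  also have "\<dots> = b A B" using pos by (simp add: K_def)
  finally show ?thesis .
qed

text \<open>Vertices are added one at a time. Each weighs at most \<eta>, so the first set to reach
  weight \<open>t\<close> overshoots by at most \<eta>.\<close>

lemma exists_subset_of_weight:
  assumes "R \<subseteq> V" "0 \<le> t" "t \<le> sum \<mu> R"
  shows "\<exists>D\<subseteq>R. t \<le> sum \<mu> D \<and> sum \<mu> D \<le> t + \<eta>"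
proof -
  have "finite R" using assms finite_sub by simp
  then have "R \<subseteq> V \<Longrightarrow> t \<le> sum \<mu> R \<Longrightarrow> \<exists>D\<subseteq>R. t \<le> sum \<mu> D \<and> sum \<mu> D \<le> t + \<eta>"
  proof (induction R)
    case empty
    then show ?case using assms(2) \<eta>_pos by (intro exI[of _ "{}"]) auto
  next
    case (insert x F)
    show ?case
    proof (cases "t \<le> sum \<mu> F")
      case True
      then show ?thesis using insert by blast
    next
      case False
      then show ?thesis using insert small_weights[of x] by (intro exI[of _ "insert x F"]) auto
    qed
  qed
  with assms show ?thesis by blast
qed

text \<open>The sets \<open>E\<close>, \<open>F\<close> and the rest form a partition without light
  parts (two parts if \<open>E = F\<close>), on which \<open>b E F\<close> is an integral of the
  averaged kernel.\<close>

lemma b_bound_large: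
  assumes "E \<subseteq> V" "F \<subseteq> V" "E = F \<or> E \<inter> F = {}"
    and "\<eta> \<le> sum \<mu> E" "\<eta> \<le> sum \<mu> F" "\<eta> \<le> sum \<mu> (V - (E \<union> F))" "sum \<mu> E \<le> \<delta>"
  shows "\<bar>b E F\<bar> \<le> \<kappa>"
proof -
  let ?P = "{E, F, V - (E \<union> F)}"
  have "E \<noteq> {}" "F \<noteq> {}" "V - (E \<union> F) \<noteq> {}" using assms(4-6) \<eta>_pos by force+
  then have P: "partition_on V ?P"
    using assms(1-3) by (intro partition_onI) (auto simp: disjnt_def)
  moreover have "\<forall>A\<in>?P. \<eta> \<le> sum \<mu> A" using assms by auto
  moreover have "sum \<mu> E * sum \<mu> F \<le> \<delta>"
    using mult_left_le[of "sum \<mu> F" "sum \<mu> E"] weight_le_1[of F] weight_nonneg[of E] assms by linarith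
  ultimately have "\<bar>kint \<mu> (stepk \<mu> ?P W) E F\<bar> \<le> \<kappa>" using assms by (intro stepk_bound) auto
  with kint_stepk_parts[OF P, of E F] show ?thesis by simp
qed

text \<open>A part lighter than \<open>\<eta>\<close> is out of reach of \<open>stepk_bound\<close>. Hence \<open>Y\<close> and \<open>Z\<close> are enlarged by sets of weight
  between \<open>\<eta>\<close> and \<open>2 \<eta>\<close> taken from the complement of \<open>Y \<union> Z\<close>, and four bilinear terms remain.\<close>

lemma b_bound_disjoint:
  assumes "Y \<subseteq> V" "Z \<subseteq> V" "Y \<inter> Z = {}" "sum \<mu> Y \<le> 3/4 * \<delta>" "1/4 \<le> sum \<mu> (V - (Y \<union> Z))"
  shows "\<bar>b Y Z\<bar> \<le> 4 * \<kappa>"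
proof -
  have "\<eta> \<le> sum \<mu> (V - (Y \<union> Z))" using assms(5) \<eta>_le \<delta>_le by simp
  then obtain D where D: "D \<subseteq> V - (Y \<union> Z)" "\<eta> \<le> sum \<mu> D" "sum \<mu> D \<le> \<eta> + \<eta>"
    using exists_subset_of_weight[OF Diff_subset less_imp_le[OF \<eta>_pos]] by meson
  let ?R = "V - (Y \<union> Z) - D"
  have R: "sum \<mu> ?R \<ge> 1/4 - 2 * \<eta>" using weight_Diff[OF D(1)] D(3) assms(5) by simp
  then have "\<eta> \<le> sum \<mu> ?R" using \<eta>_le \<delta>_le by simp
  moreover have RV: "?R \<subseteq> V" by auto
  ultimately have "\<exists>D'\<subseteq>?R. \<eta> \<le> sum \<mu> D' \<and> sum \<mu> D' \<le> \<eta> + \<eta>"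
    using \<eta>_pos by (intro exists_subset_of_weight) auto
  then obtain D' where D': "D' \<subseteq> ?R" "\<eta> \<le> sum \<mu> D'" "sum \<mu> D' \<le> \<eta> + \<eta>" by blast
  have rest: "\<eta> \<le> sum \<mu> (?R - D')"
    using weight_Diff[OF D'(1) RV] R D'(3) \<eta>_le \<delta>_le by simp
  have sub: "D \<subseteq> V" "D' \<subseteq> V" "Y \<union> D \<subseteq> V" "Z \<union> D' \<subseteq> V" using D(1) D'(1) assms by auto
  have disj: "Y \<inter> D = {}" "Z \<inter> D' = {}" "D \<inter> D' = {}" "D \<inter> Z = {}" "Y \<inter> D' = {}"
    using D(1) D'(1) by auto
  have YD: "sum \<mu> (Y \<union> D) = sum \<mu> Y + sum \<mu> D" "sum \<mu> (Z \<union> D') = sum \<mu> Z + sum \<mu> D'"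
    using weight_Un_disjoint assms sub disj by simp_all
  have bounds: "\<bar>b E F\<bar> \<le> \<kappa>" if "E = Y \<union> D \<or> E = D" "F = Z \<union> D' \<or> F = D'" for E F
  proof (rule b_bound_large)
    show "E \<subseteq> V" "F \<subseteq> V" "E = F \<or> E \<inter> F = {}" using that sub disj assms by auto
    have "?R - D' \<subseteq> V - (E \<union> F)" using that by auto
    then show "\<eta> \<le> sum \<mu> (V - (E \<union> F))"
      using weight_mono[of "?R - D'" "V - (E \<union> F)"] rest by auto
    \<comment> \<open>Here the factor 3/4 enters:
      \<open>3/4 * \<delta> + 2 * \<eta> \<le> \<delta>\<close> because
      \<open>8 * \<eta> \<le> \<delta>\<close>.\<close>
    show "\<eta> \<le> sum \<mu> E" "\<eta> \<le> sum \<mu> F" "sum \<mu> E \<le> \<delta>"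
      using that YD D D' assms(4) \<eta>_le \<eta>_pos weight_nonneg[of Y] weight_nonneg[of Z] assms(1,2) by auto
  qed
  have "b (Y \<union> D) (Z \<union> D') = b Y Z + b Y D' + b D (Z \<union> D')" "b (Y \<union> D) D' = b Y D' + b D D'"
    using b_Un_left b_Un_right assms sub disj by simp_all
  then have "b Y Z = b (Y \<union> D) (Z \<union> D') - b (Y \<union> D) D' - b D (Z \<union> D') + b D D'" by simp
  then show ?thesis
    using bounds[of "Y \<union> D" "Z \<union> D'"] bounds[of "Y \<union> D" D'] bounds[of D "Z \<union> D'"] bounds[of D D']
    by (simp add: abs_le_iff)
qed

text \<open>Enlarge \<open>Y\<close> by a disjoint \<open>D\<close> and expand the square of
  \<open>Y \<union> D\<close>. The mixed term occurs twice and is covered by the disjoint case, so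
  the constant is 1 + 2 * 4 + 1.\<close>

lemma b_bound_diagonal:
  assumes "Y \<subseteq> V" "sum \<mu> Y \<le> 3/4 * \<delta>"
  shows "\<bar>b Y Y\<bar> \<le> 10 * \<kappa>"
proof -
  have R: "sum \<mu> (V - Y) \<ge> 1 - 3/4 * \<delta>"
    using weight_Diff[of Y V] assms total_weight_1 by simp
  then have "\<eta> \<le> sum \<mu> (V - Y)" using \<eta>_le \<delta>_le by simp
  then obtain D where D: "D \<subseteq> V - Y" "\<eta> \<le> sum \<mu> D" "sum \<mu> D \<le> \<eta> + \<eta>"
    using exists_subset_of_weight[OF Diff_subset less_imp_le[OF \<eta>_pos]] by meson
  have sub: "D \<subseteq> V" "Y \<union> D \<subseteq> V" "Y \<inter> D = {}" using D(1) assms by auto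
  have rest: "1/4 \<le> sum \<mu> (V - (Y \<union> D))"
    using weight_Diff[of "Y \<union> D" V] weight_Un_disjoint[of Y D] total_weight_1 sub assms D \<delta>_le \<eta>_le
    by simp
  have rest2: "sum \<mu> (V - (Y \<union> D)) \<le> sum \<mu> (V - D)" by (intro weight_mono) auto
  have "\<bar>b (Y \<union> D) (Y \<union> D)\<bar> \<le> \<kappa>"
    using sub rest weight_Un_disjoint[of Y D] assms D \<delta>_le \<eta>_le \<eta>_pos weight_nonneg[of Y]
    by (intro b_bound_large) auto
  moreover have "\<bar>b D D\<bar> \<le> \<kappa>"
    using sub rest rest2 D \<delta>_le \<eta>_le \<eta>_pos by (intro b_bound_large) auto
  moreover have "\<bar>b Y D\<bar> \<le> 4 * \<kappa>"
    using sub rest assms by (intro b_bound_disjoint) auto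
  moreover have "b (Y \<union> D) (Y \<union> D) = b Y Y + 2 * b Y D + b D D"
    using b_Un_left[of Y D] b_Un_right[of Y D] b_commute[of D Y] sub assms by simp
  ultimately show ?thesis by (simp add: abs_le_iff)
qed

text \<open>The rectangle splits into the square of \<open>U \<inter> X\<close> and two rectangles
  with disjoint sides, each with its left side inside the light set \<open>U\<close>. This gives 10
  + 4 + 4.\<close>

lemma b_bound_reservoir:
  assumes "U \<subseteq> V" "X \<subseteq> V" "sum \<mu> U \<le> 3/4 * \<delta>" "1/4 \<le> sum \<mu> (V - (U \<union> X))"
  shows "\<bar>b U X\<bar> \<le> 18 * \<kappa>"
proof -
  let ?I = "U \<inter> X"
  have bUX: "b U X = b ?I ?I + b (U - X) ?I + b U (X - U)"
  proof -
    have "b U (?I \<union> (X - U)) = b U ?I + b U (X - U)" using assms by (intro b_Un_right) auto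
    moreover have "b (?I \<union> (U - X)) ?I = b ?I ?I + b (U - X) ?I" using assms by (intro b_Un_left) auto
    moreover have "?I \<union> (X - U) = X" "?I \<union> (U - X) = U" by auto
    ultimately show ?thesis by simp
  qed
  have I: "sum \<mu> ?I \<le> 3/4 * \<delta>" "sum \<mu> (U - X) \<le> 3/4 * \<delta>"
    using weight_mono[of ?I U] weight_mono[of "U - X" U] assms by auto
  have "sum \<mu> (V - (U \<union> X)) \<le> sum \<mu> (V - (U - X \<union> ?I))" by (intro weight_mono) auto
  moreover have "V - (U \<union> (X - U)) = V - (U \<union> X)" by auto
  ultimately have "\<bar>b (U - X) ?I\<bar> \<le> 4 * \<kappa>" "\<bar>b U (X - U)\<bar> \<le> 4 * \<kappa>"
    using assms I by (intro b_bound_disjoint; auto)+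
  moreover have "\<bar>b ?I ?I\<bar> \<le> 10 * \<kappa>" using I assms by (intro b_bound_diagonal) auto
  ultimately show ?thesis using bUX by (simp add: abs_le_iff)
qed

text \<open>Splitting \<open>X\<close> along a set of about half the weight leaves enough room outside of both pieces.\<close>

lemma b_bound_small:
  assumes "U \<subseteq> V" "X \<subseteq> V" "sum \<mu> U \<le> 3/4 * \<delta>"
  shows "\<bar>b U X\<bar> \<le> 36 * \<kappa>"
proof -
  obtain H where H: "H \<subseteq> V" "1/2 \<le> sum \<mu> H" "sum \<mu> H \<le> 1/2 + \<eta>"
    using exists_subset_of_weight[of V "1/2"] total_weight_1 by auto
  \<comment> \<open>The set \<open>U\<close> weighs at most 3/32 and \<eta> is at most 1/64, so
    removing \<open>U\<close> and slightly more than half of \<open>V\<close> leaves over a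
    quarter.\<close>
  have res: "1/4 \<le> sum \<mu> (V - (U \<union> Z))" if "Z \<subseteq> V" "sum \<mu> Z \<le> 1/2 + \<eta>" for Z
    using weight_Diff[of "U \<union> Z" V] weight_Un_le[of U Z] that assms total_weight_1 \<eta>_le \<delta>_le by simp
  have "sum \<mu> (X \<inter> H) \<le> 1/2 + \<eta>" using weight_mono[of "X \<inter> H" H] H by simp
  moreover have "sum \<mu> (X - H) \<le> 1/2 + \<eta>"
    using weight_mono[OF Diff_mono[OF assms(2) order_refl] Diff_subset, of H] weight_Diff[OF H(1)] H
      total_weight_1 \<eta>_pos by simp
  ultimately have "\<bar>b U (X \<inter> H)\<bar> \<le> 18 * \<kappa>" "\<bar>b U (X - H)\<bar> \<le> 18 * \<kappa>"
    using assms res[of "X \<inter> H"] res[of "X - H"] by (intro b_bound_reservoir; auto)+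
  moreover have "b U (X \<inter> H \<union> (X - H)) = b U (X \<inter> H) + b U (X - H)"
    using assms by (intro b_Un_right) auto
  moreover have "X \<inter> H \<union> (X - H) = X" by auto
  ultimately show ?thesis by (simp add: abs_le_iff)
qed

text \<open>Exchange first \<open>S\<close> for \<open>S'\<close>, then \<open>T\<close> for
  \<open>T'\<close>. Each exchange costs two rectangles having one side inside the light set
  \<open>M\<close>. The kernel \<open>K\<close> is arbitrary because the bound is applied both to
  \<open>W\<close> and to its averaged version.\<close>

lemma kint_diff_bound:
  assumes "S \<subseteq> V" "S' \<subseteq> V" "T \<subseteq> V" "T' \<subseteq> V"
    and left: "\<And>U X. U \<subseteq> V \<Longrightarrow> X \<subseteq> V \<Longrightarrow> sum \<mu> U \<le> r \<Longrightarrow> \<bar>kint \<mu> K U X\<bar> \<le> c"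
    and right: "\<And>U X. U \<subseteq> V \<Longrightarrow> X \<subseteq> V \<Longrightarrow> sum \<mu> X \<le> r \<Longrightarrow> \<bar>kint \<mu> K U X\<bar> \<le> c"
    and M: "M \<subseteq> V" "sum \<mu> M \<le> r" "S - S' \<subseteq> M" "S' - S \<subseteq> M" "T - T' \<subseteq> M" "T' - T \<subseteq> M"
  shows "\<bar>kint \<mu> K S T - kint \<mu> K S' T'\<bar> \<le> 4 * c"
proof -
  have fin: "finite S" "finite S'" "finite T" "finite T'" using assms finite_sub by auto
  have *: "kint \<mu> K A X - kint \<mu> K B X = kint \<mu> K (A - B) X - kint \<mu> K (B - A) X"
    if "finite A" "finite B" for A B X
  proof -
    have "kint \<mu> K (A \<inter> B \<union> (A - B)) X = kint \<mu> K (A \<inter> B) X + kint \<mu> K (A - B) X"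
      "kint \<mu> K (A \<inter> B \<union> (B - A)) X = kint \<mu> K (A \<inter> B) X + kint \<mu> K (B - A) X"
      using that by (auto intro!: kint_Un_left)
    moreover have "A \<inter> B \<union> (A - B) = A" "A \<inter> B \<union> (B - A) = B" by auto
    ultimately show ?thesis by simp
  qed
  have **: "kint \<mu> K X A - kint \<mu> K X B = kint \<mu> K X (A - B) - kint \<mu> K X (B - A)"
    if "finite A" "finite B" for A B X
  proof -
    have "kint \<mu> K X (A \<inter> B \<union> (A - B)) = kint \<mu> K X (A \<inter> B) + kint \<mu> K X (A - B)"
      "kint \<mu> K X (A \<inter> B \<union> (B - A)) = kint \<mu> K X (A \<inter> B) + kint \<mu> K X (B - A)"
      using that by (auto intro!: kint_Un_right)
    moreover have "A \<inter> B \<union> (A - B) = A" "A \<inter> B \<union> (B - A) = B" by auto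
    ultimately show ?thesis by simp
  qed
  have small: "sum \<mu> Z \<le> r" if "Z \<subseteq> M" for Z using weight_mono[OF that M(1)] M(2) by simp
  have "\<bar>kint \<mu> K (S - S') T\<bar> \<le> c" "\<bar>kint \<mu> K (S' - S) T\<bar> \<le> c"
    "\<bar>kint \<mu> K S' (T - T')\<bar> \<le> c" "\<bar>kint \<mu> K S' (T' - T)\<bar> \<le> c"
    using assms small by (auto intro!: left right)
  then show ?thesis using *[OF fin(1,2), of T] **[OF fin(3,4), of S'] by (simp add: abs_le_iff)
qed

text \<open>Four rectangles at \<open>36 * \<kappa>\<close> each; symmetry of \<open>W\<close> moves
  a light right side to the left.\<close>

lemma b_diff_bound:
  assumes "S \<subseteq> V" "S' \<subseteq> V" "T \<subseteq> V" "T' \<subseteq> V"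
    and "M \<subseteq> V" "sum \<mu> M \<le> 3/4 * \<delta>" "S - S' \<subseteq> M" "S' - S \<subseteq> M" "T - T' \<subseteq> M" "T' - T \<subseteq> M"
  shows "\<bar>b S T - b S' T'\<bar> \<le> 144 * \<kappa>"
proof -
  have "\<bar>b U X\<bar> \<le> 36 * \<kappa>" if "U \<subseteq> V" "X \<subseteq> V" "sum \<mu> X \<le> 3/4 * \<delta>" for U X
    using b_bound_small[of X U] b_commute[of U X] that by simp
  then show ?thesis
    using kint_diff_bound[OF assms(1-4) b_bound_small _ assms(5-)] by simp
qed

text \<open>For the averaged kernel \<open>stepk_bound\<close> applies at once: all weights are at
  most 1, so one light side makes the whole rectangle light. Hence the constant is only 4.\<close>

lemma stepk_diff_bound:
  assumes "partition_on V P" "\<forall>A\<in>P. \<eta> \<le> sum \<mu> A"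
    and "S \<subseteq> V" "S' \<subseteq> V" "T \<subseteq> V" "T' \<subseteq> V"
    and "M \<subseteq> V" "sum \<mu> M \<le> 3/4 * \<delta>" "S - S' \<subseteq> M" "S' - S \<subseteq> M" "T - T' \<subseteq> M" "T' - T \<subseteq> M"
  shows "\<bar>kint \<mu> (stepk \<mu> P W) S T - kint \<mu> (stepk \<mu> P W) S' T'\<bar> \<le> 4 * \<kappa>"
proof (rule kint_diff_bound[OF assms(3-6) _ _ assms(7-)])
  fix U X assume UX: "U \<subseteq> V" "X \<subseteq> V"
  have *: "sum \<mu> U * sum \<mu> X \<le> sum \<mu> U" "sum \<mu> U * sum \<mu> X \<le> sum \<mu> X"
    using UX weight_le_1 weight_nonneg by (auto intro: mult_left_le mult_left_le_one_le)
  have "0 < \<delta>" using \<eta>_pos \<eta>_le by simp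
  with * show "\<bar>kint \<mu> (stepk \<mu> P W) U X\<bar> \<le> \<kappa>" if "sum \<mu> U \<le> 3/4 * \<delta>"
    using UX assms(1,2) that by (intro stepk_bound) auto
  from * \<open>0 < \<delta>\<close> show "\<bar>kint \<mu> (stepk \<mu> P W) U X\<bar> \<le> \<kappa>" if "sum \<mu> X \<le> 3/4 * \<delta>"
    using UX assms(1,2) that by (intro stepk_bound) auto
qed

end

section \<open>Refinements without light parts\<close>

text \<open>Membership in \<open>S\<close> and \<open>T\<close> cuts each part into four cells, and
  light cells are recoloured to join a heavy cell of the same part; a part all of whose cells are
  light stays whole. Reading \<open>S'\<close> and \<open>T'\<close> off the colours makes them
  unions of new parts, and \<open>M\<close> collects the recoloured points.\<close>

lemma rounded_refinement:
  fixes \<mu> :: "'a \<Rightarrow> real"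
  assumes "finite V" and pos: "\<And>x. x \<in> V \<Longrightarrow> \<mu> x \<ge> 0" and \<eta>: "\<eta> > 0"
    and P: "partition_on V P" and parts: "\<forall>A\<in>P. \<eta> \<le> sum \<mu> A"
    and "S \<subseteq> V" "T \<subseteq> V"
  obtains Q S' T' M where "partition_on V Q" "\<forall>B\<in>Q. \<exists>A\<in>P. B \<subseteq> A" "\<forall>B\<in>Q. \<eta> \<le> sum \<mu> B"
    "card Q \<le> 4 * card P" "S' \<subseteq> V" "T' \<subseteq> V"
    "\<forall>B\<in>Q. B \<subseteq> S' \<or> B \<inter> S' = {}" "\<forall>B\<in>Q. B \<subseteq> T' \<or> B \<inter> T' = {}"
    "M \<subseteq> V" "sum \<mu> M \<le> 3 * \<eta> * card P"
    "S - S' \<subseteq> M" "S' - S \<subseteq> M" "T - T' \<subseteq> M" "T' - T \<subseteq> M"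
proof -
  have card4: "card (UNIV :: (bool \<times> bool) set) = 4"
    by (simp add: card_cartesian_product flip: UNIV_Times_UNIV)
  have finP: "finite P" using finite_elements[OF assms(1) P] .
  have subV: "A \<subseteq> V" if "A \<in> P" for A using that partition_onD1[OF P] by blast
  have mono: "sum \<mu> A \<le> sum \<mu> B" if "A \<subseteq> B" "B \<subseteq> V" for A B
    using that pos assms(1) by (intro sum_mono2) (auto intro: finite_subset)
  define cell where "cell A k = {x \<in> A. (x \<in> S, x \<in> T) = k}" for A k
  \<comment> \<open>the colour of some heavy cell of \<open>A\<close>, which absorbs the light ones; arbitrary if all are light\<close>
  define top where "top A = (SOME k. (\<exists>k. \<eta> \<le> sum \<mu> (cell A k)) \<longrightarrow> \<eta> \<le> sum \<mu> (cell A k))" for A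
  have top: "\<eta> \<le> sum \<mu> (cell A (top A))" if "\<eta> \<le> sum \<mu> (cell A k)" for A k
  proof -
    have "\<exists>k. (\<exists>k. \<eta> \<le> sum \<mu> (cell A k)) \<longrightarrow> \<eta> \<le> sum \<mu> (cell A k)" by blast
    from someI_ex[OF this] that show ?thesis unfolding top_def by blast
  qed
  define col where "col x = (if \<eta> \<le> sum \<mu> (cell (part_of P x) (x \<in> S, x \<in> T))
    then (x \<in> S, x \<in> T) else top (part_of P x))" for x
  define blk where "blk A k = {x \<in> A. col x = k}" for A k
  define Q where "Q = (\<lambda>(A, k). blk A k) ` (P \<times> UNIV) - {{}}"
  define S' where "S' = {x \<in> V. fst (col x)}"
  define T' where "T' = {x \<in> V. snd (col x)}"
  define M where "M = {x \<in> V. col x \<noteq> (x \<in> S, x \<in> T)}"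
  have pof: "part_of P x = A" if "A \<in> P" "x \<in> A" for A x using part_of_eq[OF P that] .
  have QE: "\<exists>A k. A \<in> P \<and> B = blk A k" if "B \<in> Q" for B using that by (auto simp: Q_def)
  have "partition_on V Q"
  proof (rule partition_onI)
    show "\<Union>Q = V"
    proof
      show "\<Union>Q \<subseteq> V" using QE subV by (fastforce simp: blk_def)
      show "V \<subseteq> \<Union>Q"
      proof
        fix x assume "x \<in> V"
        then have "x \<in> blk (part_of P x) (col x)" "part_of P x \<in> P"
          using part_of_props[OF P] by (auto simp: blk_def)
        then show "x \<in> \<Union>Q" unfolding Q_def by blast
      qed
    qed
    show "{} \<notin> Q" by (simp add: Q_def)
    fix B B' assume "B \<in> Q" "B' \<in> Q" "B \<noteq> B'"
    then obtain A k A' k' where *: "A \<in> P" "B = blk A k" "A' \<in> P" "B' = blk A' k'" using QE by metis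
    show "disjnt B B'" unfolding disjnt_iff
    proof (intro allI notI)
      fix x assume x: "x \<in> B \<and> x \<in> B'"
      then have "A = A'" "k = k'" using * pof by (auto simp: blk_def)
      with * \<open>B \<noteq> B'\<close> show False by simp
    qed
  qed
  moreover have "\<forall>B\<in>Q. \<exists>A\<in>P. B \<subseteq> A" using QE by (fastforce simp: blk_def)
  moreover have "\<forall>B\<in>Q. \<eta> \<le> sum \<mu> B"
  proof
    fix B assume "B \<in> Q"
    with QE obtain A k where A: "A \<in> P" "B = blk A k" by blast
    from \<open>B \<in> Q\<close> have "B \<noteq> {}" by (simp add: Q_def)
    then obtain x where x: "x \<in> A" "col x = k" using A by (auto simp: blk_def)
    have BV: "B \<subseteq> V" using subV[OF A(1)] A(2) by (auto simp: blk_def)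
    show "\<eta> \<le> sum \<mu> B"
    proof (cases "\<eta> \<le> sum \<mu> (cell A k)")
      case True
      have "cell A k \<subseteq> B" using True pof[OF A(1)] by (auto simp: A(2) blk_def cell_def col_def)
      from mono[OF this BV] True show ?thesis by simp
    next
      case False
      \<comment> \<open>A point keeps its own colour only in a heavy cell, so a block whose colour
        belongs to a light cell was coloured by \<open>top\<close>. Then no cell of \<open>A\<close>
        is heavy, and the block is all of \<open>A\<close>.\<close>
      have k: "k = top A" using x False pof[OF A(1) x(1)] by (auto simp: col_def split: if_splits)
      then have "\<not> \<eta> \<le> sum \<mu> (cell A j)" for j using top False by blast
      then have "B = A" using pof[OF A(1)] k by (auto simp: A(2) blk_def col_def)
      then show ?thesis using parts A(1) by simp
    qed
  qed
  moreover have "card Q \<le> 4 * card P"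
  proof -
    have "card Q \<le> card ((\<lambda>(A, k). blk A k) ` (P \<times> (UNIV :: (bool \<times> bool) set)))"
      unfolding Q_def using finP by (intro card_mono) auto
    also have "\<dots> \<le> card (P \<times> (UNIV :: (bool \<times> bool) set))" using finP by (intro card_image_le) auto
    also have "\<dots> = 4 * card P" using card4 by (simp add: card_cartesian_product)
    finally show ?thesis .
  qed
  moreover have "S' \<subseteq> V" "T' \<subseteq> V" "M \<subseteq> V" by (auto simp: S'_def T'_def M_def)
  moreover have "\<forall>B\<in>Q. B \<subseteq> S' \<or> B \<inter> S' = {}" "\<forall>B\<in>Q. B \<subseteq> T' \<or> B \<inter> T' = {}"
    using QE subV by (fastforce simp: blk_def S'_def T'_def)+
  moreover have "sum \<mu> M \<le> 3 * \<eta> * card P"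
  proof -
    have "sum \<mu> M = (\<Sum>x\<in>V. if x \<in> M then \<mu> x else 0)"
      using assms(1) by (simp add: M_def sum.inter_filter)
    also have "\<dots> = (\<Sum>A\<in>P. \<Sum>x\<in>A. if x \<in> M then \<mu> x else 0)" by (rule sum_over_partition[OF assms(1) P])
    also have "\<dots> \<le> (\<Sum>A\<in>P. 3 * \<eta>)"
    proof (rule sum_mono)
      fix A assume A: "A \<in> P"
      have finA: "finite A" using subV[OF A] assms(1) by (rule finite_subset)
      \<comment> \<open>These are the colours that get changed. Even if all four cells are light,
        the points of colour \<open>top A\<close> keep it, so at most three cells move.\<close>
      define J where "J = {k. \<not> \<eta> \<le> sum \<mu> (cell A k)} - {top A}"
      have finJ: "finite J" by simp
      have "card J \<le> card (UNIV - {top A})" unfolding J_def by (intro card_mono) auto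
      also have "\<dots> = 3" using card4 by (simp add: card_Diff_singleton)
      finally have J3: "card J \<le> 3" .
      have M_sub: "A \<inter> M \<subseteq> (\<Union>k\<in>J. cell A k)"
      proof
        fix x assume "x \<in> A \<inter> M"
        then have "x \<in> A" "col x \<noteq> (x \<in> S, x \<in> T)" by (auto simp: M_def)
        then have "(x \<in> S, x \<in> T) \<in> J" using pof[OF A] by (auto simp: J_def col_def split: if_splits)
        then show "x \<in> (\<Union>k\<in>J. cell A k)" using \<open>x \<in> A\<close> by (auto simp: cell_def)
      qed
      have cellA: "cell A k \<subseteq> A" for k by (auto simp: cell_def)
      have "(\<Sum>x\<in>A. if x \<in> M then \<mu> x else 0) = sum \<mu> (A \<inter> M)"
        using finA by (simp add: sum.If_cases Int_def)
      also have "\<dots> \<le> sum \<mu> (\<Union>k\<in>J. cell A k)"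
        using cellA subV[OF A] by (intro mono M_sub) blast
      also have "\<dots> = (\<Sum>k\<in>J. sum \<mu> (cell A k))"
        using finA finJ by (intro sum.UNION_disjoint) (auto simp: cell_def)
      also have "\<dots> \<le> (\<Sum>k\<in>J. \<eta>)" by (intro sum_mono) (auto simp: J_def)
      also have "\<dots> \<le> 3 * \<eta>" using J3 \<eta> by simp
      finally show "(\<Sum>x\<in>A. if x \<in> M then \<mu> x else 0) \<le> 3 * \<eta>" .
    qed
    finally show ?thesis by (simp add: mult.commute)
  qed
  moreover have "S - S' \<subseteq> M" "S' - S \<subseteq> M" "T - T' \<subseteq> M" "T' - T \<subseteq> M"
    using assms(6,7) by (auto simp: S'_def T'_def M_def)
  ultimately show ?thesis by - (rule that[of Q S' T' M]; assumption)
qed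

section \<open>Energy increment\<close>

definition pair_weight :: "('a \<Rightarrow> real) \<Rightarrow> 'a \<times> 'a \<Rightarrow> real" where
  "pair_weight \<mu> z = \<mu> (fst z) * \<mu> (snd z)"

lemma sum_pair_weight:
  "(\<Sum>z\<in>A \<times> B. pair_weight \<mu> z * f z) = (\<Sum>s\<in>A. \<Sum>t\<in>B. \<mu> s * \<mu> t * f (s, t))"
  by (simp add: sum.cartesian_product pair_weight_def case_prod_beta)

text \<open>The weight of a product of parts factors, so the two-variable average is one conditional
  expectation on the space of pairs.\<close>

lemma stepk_eq_cexp:
  assumes "partition_on V P" "x \<in> V" "y \<in> V"
  shows "stepk \<mu> P W x y = cexp (pair_weight \<mu>) (prod_partition P) (\<lambda>z. W (fst z) (snd z)) (x, y)"
proof -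
  have "sum (pair_weight \<mu>) (A \<times> B) = sum \<mu> A * sum \<mu> B" for A B
    using sum_pair_weight[of \<mu> "\<lambda>_. 1" A B] by (simp add: sum_product)
  then show ?thesis
    by (simp add: cexp_def part_of_prod_partition[OF assms] sum_pair_weight stepk_def kint_def)
qed

section \<open>Refinement steps and their orthogonal test functions\<close>

context regular_kernel
begin

abbreviation \<nu> where "\<nu> \<equiv> pair_weight \<mu>"
abbreviation W2 where "W2 z \<equiv> W (fst z) (snd z)"
abbreviation rect :: "'a set \<Rightarrow> 'a set \<Rightarrow> 'a \<times> 'a \<Rightarrow> real" where "rect S T \<equiv> indicat_real (S \<times> T)"

text \<open>The partitions to which \<open>stepk_bound\<close> applies.\<close>

definition admissible :: "'a set set \<Rightarrow> bool" where
  "admissible P \<longleftrightarrow> partition_on V P \<and> (\<forall>A\<in>P. \<eta> \<le> sum \<mu> A)"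

sublocale pairs: weighted_space "V \<times> V" \<nu>
  using finite_V weight_pos by unfold_locales (auto simp: pair_weight_def)

lemma kint_eq_sum_pairs:
  assumes "S \<subseteq> V" "T \<subseteq> V"
  shows "kint \<mu> K S T = (\<Sum>z\<in>V \<times> V. \<nu> z * K (fst z) (snd z) * rect S T z)"
proof -
  have "kint \<mu> K S T = (\<Sum>z\<in>S \<times> T. \<nu> z * K (fst z) (snd z))"
    by (simp add: kint_def sum_pair_weight)
  also have "\<dots> = (\<Sum>z\<in>V \<times> V. \<nu> z * K (fst z) (snd z) * rect S T z)"
    using assms finite_V by (intro sum.mono_neutral_cong_left) (auto simp: indicator_def)
  finally show ?thesis .
qed

text \<open>Self-adjointness moves the averaging from the kernel to the indicator. Thus the
  discrepancy on a rectangle is the pairing of \<open>W\<close> with the indicator minus its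
  conditional expectation.\<close>

lemma kint_stepk_eq_sum_pairs:
  assumes "partition_on V P" "S \<subseteq> V" "T \<subseteq> V"
  shows "kint \<mu> (stepk \<mu> P W) S T = (\<Sum>z\<in>V \<times> V. \<nu> z * W2 z * cexp \<nu> (prod_partition P) (rect S T) z)"
proof -
  have "kint \<mu> (stepk \<mu> P W) S T
      = (\<Sum>z\<in>V \<times> V. \<nu> z * cexp \<nu> (prod_partition P) W2 z * rect S T z)"
    unfolding kint_eq_sum_pairs[OF assms(2,3)]
    using stepk_eq_cexp[OF assms(1)] by (intro sum.cong) auto
  then show ?thesis
    using pairs.sum_cexp_commute[OF partition_on_prod_partition[OF assms(1)]] by simp
qed

text \<open>The record of \<open>n\<close> refinement steps: orthogonal functions, all measurable on
  the current partition, each correlating with \<open>W\<close> by at least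
  \<open>c\<close>.\<close>

definition test_family :: "'a set set \<Rightarrow> real \<Rightarrow> nat \<Rightarrow> (nat \<Rightarrow> 'a \<times> 'a \<Rightarrow> real) \<Rightarrow> bool" where
  "test_family P c n u \<longleftrightarrow>
     (\<forall>i<n. const_on_parts (prod_partition P) (u i) \<and> (\<forall>z\<in>V \<times> V. \<bar>u i z\<bar> \<le> 1) \<and>
        c \<le> \<bar>\<Sum>z\<in>V \<times> V. \<nu> z * W2 z * u i z\<bar>) \<and>
     (\<forall>i<n. \<forall>j<n. i \<noteq> j \<longrightarrow> (\<Sum>z\<in>V \<times> V. \<nu> z * u i z * u j z) = 0)"

text \<open>The failing pair is rounded to unions of parts of \<open>Q\<close> and contributes the
  new function \<open>w\<close>, while the old functions remain constant on the finer parts. The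
  bound on \<open>card P\<close> keeps the rounding error set within weight
  \<open>3/4 * \<delta>\<close>.\<close>

lemma test_family_step:
  assumes P: "admissible P" and u: "test_family P (e - 148 * \<kappa>) n u"
    and card: "3 * \<eta> * card P \<le> 3/4 * \<delta>"
    and ST: "S \<subseteq> V" "T \<subseteq> V" and far: "e < \<bar>b S T - kint \<mu> (stepk \<mu> P W) S T\<bar>"
  obtains Q v where "admissible Q" "card Q \<le> 4 * card P" "test_family Q (e - 148 * \<kappa>) (Suc n) v"
proof -
  have P': "partition_on V P" "\<forall>A\<in>P. \<eta> \<le> sum \<mu> A" using P by (auto simp: admissible_def)
  note PP = partition_on_prod_partition[OF P'(1)]
  obtain Q S' T' M where Q: "partition_on V Q" "\<forall>B\<in>Q. \<exists>A\<in>P. B \<subseteq> A" "\<forall>B\<in>Q. \<eta> \<le> sum \<mu> B"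
    "card Q \<le> 4 * card P" and ST': "S' \<subseteq> V" "T' \<subseteq> V"
    "\<forall>B\<in>Q. B \<subseteq> S' \<or> B \<inter> S' = {}" "\<forall>B\<in>Q. B \<subseteq> T' \<or> B \<inter> T' = {}"
    and M: "M \<subseteq> V" "sum \<mu> M \<le> 3 * \<eta> * card P"
    "S - S' \<subseteq> M" "S' - S \<subseteq> M" "T - T' \<subseteq> M" "T' - T \<subseteq> M"
    by (rule rounded_refinement[OF finite_V less_imp_le[OF weight_pos] \<eta>_pos P' ST])
  define w where "w z = rect S' T' z - cexp \<nu> (prod_partition P) (rect S' T') z" for z
  define v where "v = u(n := w)"
  have w_const: "const_on_parts (prod_partition Q) w"
  proof -
    have "const_on_parts (prod_partition Q) (cexp \<nu> (prod_partition P) (rect S' T'))"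
      using pairs.const_on_parts_cexp[OF PP] refines_prod_partition[OF Q(2)]
      by (rule const_on_parts_refine)
    moreover have "const_on_parts (prod_partition Q) (rect S' T')"
      unfolding const_on_parts_def
    proof (intro ballI)
      fix Z x y assume Z: "Z \<in> prod_partition Q" "x \<in> Z" "y \<in> Z"
      then obtain B B' where B: "B \<in> Q" "B' \<in> Q" "Z = B \<times> B'"
        by (auto simp: prod_partition_def)
      have "fst x \<in> B" "fst y \<in> B" "snd x \<in> B'" "snd y \<in> B'" using B(3) Z(2,3) by auto
      then have "fst x \<in> S' \<longleftrightarrow> fst y \<in> S'" "snd x \<in> T' \<longleftrightarrow> snd y \<in> T'"
        using ST'(3,4) B(1,2) by blast+
      then have "x \<in> S' \<times> T' \<longleftrightarrow> y \<in> S' \<times> T'" by (simp add: mem_Times_iff)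
      then show "rect S' T' x = rect S' T' y" by (simp add: indicator_def)
    qed
    ultimately show ?thesis unfolding w_def by (rule const_on_parts_diff[rotated])
  qed
  have w_le: "\<bar>w z\<bar> \<le> 1" if z: "z \<in> V \<times> V" for z
  proof -
    have "0 \<le> cexp \<nu> (prod_partition P) (rect S' T') z" "cexp \<nu> (prod_partition P) (rect S' T') z \<le> 1"
      using z by (intro pairs.cexp_bounds[OF PP]; simp)+
    moreover have "0 \<le> rect S' T' z" "rect S' T' z \<le> 1" by simp_all
    ultimately show ?thesis unfolding w_def by linarith
  qed
  \<comment> \<open>Averaging over \<open>P\<close> does not change the pairing with
    \<open>u i\<close>, which is constant on the product parts, so the two terms of \<open>w\<close>
    cancel.\<close>
  have w_orth: "(\<Sum>z\<in>V \<times> V. \<nu> z * w z * u i z) = 0" if "i < n" for i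
  proof -
    have "const_on_parts (prod_partition P) (u i)" using u that by (simp add: test_family_def)
    from pairs.sum_cexp_const_on_parts[OF PP this, of "rect S' T'"] show ?thesis
      by (simp add: w_def algebra_simps sum_subtractf)
  qed
  have "(\<Sum>z\<in>V \<times> V. \<nu> z * W2 z * w z) = b S' T' - kint \<mu> (stepk \<mu> P W) S' T'"
    using kint_eq_sum_pairs[OF ST'(1,2), of W] kint_stepk_eq_sum_pairs[OF P'(1) ST'(1,2)]
    by (simp add: w_def algebra_simps sum_subtractf)
  moreover have "sum \<mu> M \<le> 3/4 * \<delta>" using M(2) card by linarith
  \<comment> \<open>Rounding changes the two integrals by at most \<open>144 * \<kappa>\<close> and
    \<open>4 * \<kappa>\<close>; their sum is the loss \<open>148 * \<kappa>\<close>.\<close>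
  then have "\<bar>b S T - b S' T'\<bar> \<le> 144 * \<kappa>"
    "\<bar>kint \<mu> (stepk \<mu> P W) S T - kint \<mu> (stepk \<mu> P W) S' T'\<bar> \<le> 4 * \<kappa>"
    using b_diff_bound[OF ST(1) ST'(1) ST(2) ST'(2) M(1) _ M(3-)]
      stepk_diff_bound[OF P' ST(1) ST'(1) ST(2) ST'(2) M(1) _ M(3-)] by simp_all
  ultimately have w_corr: "e - 148 * \<kappa> \<le> \<bar>\<Sum>z\<in>V \<times> V. \<nu> z * W2 z * w z\<bar>" using far by linarith
  have u_const: "const_on_parts (prod_partition Q) (u i)" if "i < n" for i
  proof (rule const_on_parts_refine[OF _ refines_prod_partition[OF Q(2)]])
    show "const_on_parts (prod_partition P) (u i)" using u that by (simp add: test_family_def)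
  qed
  have w_orth': "(\<Sum>z\<in>V \<times> V. \<nu> z * u i z * w z) = 0" if "i < n" for i
    using w_orth[OF that] by (simp add: mult_ac)
  have "test_family Q (e - 148 * \<kappa>) (Suc n) v"
    unfolding test_family_def
  proof (intro conjI allI impI)
    fix i assume i: "i < Suc n"
    show "const_on_parts (prod_partition Q) (v i)"
      using i u_const w_const by (cases "i = n") (auto simp: v_def)
    show "\<forall>z\<in>V \<times> V. \<bar>v i z\<bar> \<le> 1"
      using i w_le u by (cases "i = n") (auto simp: v_def test_family_def)
    show "e - 148 * \<kappa> \<le> \<bar>\<Sum>z\<in>V \<times> V. \<nu> z * W2 z * v i z\<bar>"
      using i w_corr u by (cases "i = n") (auto simp: v_def test_family_def)
    fix j assume j: "j < Suc n" "i \<noteq> j"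
    show "(\<Sum>z\<in>V \<times> V. \<nu> z * v i z * v j z) = 0"
      using i j w_orth w_orth' u by (cases "i = n"; cases "j = n") (auto simp: v_def test_family_def)
  qed
  moreover have "admissible Q" using Q by (simp add: admissible_def)
  ultimately show ?thesis using that Q(4) by blast
qed

text \<open>Iteration of \<open>test_family_step\<close> from the trivial partition and the empty
  family.\<close>

lemma exists_test_family:
  assumes fail: "\<And>P. admissible P \<Longrightarrow> card P \<le> 4 ^ K \<Longrightarrow>
      \<exists>S\<subseteq>V. \<exists>T\<subseteq>V. e < \<bar>b S T - kint \<mu> (stepk \<mu> P W) S T\<bar>"
    and K: "4 * \<eta> * 4 ^ K \<le> \<delta>"
  shows "n \<le> Suc K \<Longrightarrow> \<exists>P u. admissible P \<and> card P \<le> 4 ^ n \<and> test_family P (e - 148 * \<kappa>) n u"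
proof (induction n)
  case 0
  have "V \<noteq> {}" using total_weight_1 by auto
  then have "admissible {V}"
    using total_weight_1 \<eta>_le \<delta>_le \<eta>_pos by (auto simp: admissible_def intro!: partition_onI)
  then show ?case by (intro exI[of _ "{V}"]) (auto simp: test_family_def)
next
  case (Suc n)
  then obtain P u where P: "admissible P" "card P \<le> 4 ^ n" "test_family P (e - 148 * \<kappa>) n u" by auto
  \<comment> \<open>A step starts from index at most \<open>K\<close>, so it only refines partitions
    with at most \<open>4 ^ K\<close> parts. The last one may have \<open>4 ^ Suc K\<close> parts;
    it merely carries the \<open>Suc K\<close> functions.\<close>
  have "card P \<le> 4 ^ K" using P(2) Suc.prems by (auto intro: order_trans power_increasing)
  moreover from this have "real (card P) \<le> 4 ^ K" by (metis of_nat_le_iff of_nat_numeral of_nat_power)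
  then have "3 * \<eta> * card P \<le> 3 * \<eta> * 4 ^ K" using \<eta>_pos by (intro mult_left_mono) auto
  then have "3 * \<eta> * card P \<le> 3/4 * \<delta>" using K by simp
  moreover obtain S T where "S \<subseteq> V" "T \<subseteq> V" "e < \<bar>b S T - kint \<mu> (stepk \<mu> P W) S T\<bar>"
    using fail[OF P(1) \<open>card P \<le> 4 ^ K\<close>] by blast
  ultimately obtain Q v where "admissible Q" "card Q \<le> 4 * card P"
      "test_family Q (e - 148 * \<kappa>) (Suc n) v"
    using test_family_step[OF P(1,3)] by metis
  with P(2) show ?case by (intro exI[of _ Q] exI[of _ v]) auto
qed

text \<open>If every admissible partition with at most \<open>4 ^ K\<close> parts failed, there
  would be \<open>Suc K\<close> orthogonal functions, each still correlating with \<open>g\<close>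
  after the loss of \<open>a\<close>. Bessel's inequality would then push the squared norm of
  \<open>g\<close> above \<open>E\<close>.\<close>

lemma weak_regularity:
  assumes K: "4 * \<eta> * 4 ^ K \<le> \<delta>"
    and split: "\<And>P. admissible P \<Longrightarrow> \<exists>g. (\<Sum>z\<in>V \<times> V. \<nu> z * \<bar>stepk \<mu> P W (fst z) (snd z) - g z\<bar>) \<le> a \<and>
      (\<Sum>z\<in>V \<times> V. \<nu> z * (g z)\<^sup>2) \<le> E"
    and e: "0 \<le> e - 148 * \<kappa> - a" and E: "E < real (Suc K) * (e - 148 * \<kappa> - a)\<^sup>2"
  shows "\<exists>P. admissible P \<and> card P \<le> 4 ^ K \<and>
    (\<forall>S\<subseteq>V. \<forall>T\<subseteq>V. \<bar>b S T - kint \<mu> (stepk \<mu> P W) S T\<bar> \<le> e)"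
proof (rule ccontr)
  assume "\<not> ?thesis"
  then have "\<exists>S\<subseteq>V. \<exists>T\<subseteq>V. e < \<bar>b S T - kint \<mu> (stepk \<mu> P W) S T\<bar>"
    if "admissible P" "card P \<le> 4 ^ K" for P using that by (meson not_le)
  from exists_test_family[OF this K, of "Suc K"] obtain P u
    where P: "admissible P" and u: "test_family P (e - 148 * \<kappa>) (Suc K) u" by auto
  obtain g where g: "(\<Sum>z\<in>V \<times> V. \<nu> z * \<bar>stepk \<mu> P W (fst z) (snd z) - g z\<bar>) \<le> a"
      "(\<Sum>z\<in>V \<times> V. \<nu> z * (g z)\<^sup>2) \<le> E"
    using split[OF P] by blast
  have P': "partition_on V P" using P by (simp add: admissible_def)
  have \<nu>0: "0 \<le> \<nu> z" if "z \<in> V \<times> V" for z using pairs.weight_pos[OF that] by simp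
  have total: "(\<Sum>z\<in>V \<times> V. \<nu> z) = 1"
    using sum_pair_weight[of \<mu> "\<lambda>_. 1" V V] total_weight_1 by (simp flip: sum_product)
  have "(e - 148 * \<kappa> - a)\<^sup>2 \<le> (\<Sum>z\<in>V \<times> V. \<nu> z * g z * u i z)\<^sup>2" if i: "i < Suc K" for i
  proof -
    let ?f = "\<lambda>z. stepk \<mu> P W (fst z) (snd z)"
    have ui: "const_on_parts (prod_partition P) (u i)" "\<And>z. z \<in> V \<times> V \<Longrightarrow> \<bar>u i z\<bar> \<le> 1"
      "e - 148 * \<kappa> \<le> \<bar>\<Sum>z\<in>V \<times> V. \<nu> z * W2 z * u i z\<bar>"
      using u i unfolding test_family_def by blast+
    \<comment> \<open>All \<open>u i\<close> are measurable on the final partition \<open>P\<close>,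
      so the single split of its averaged kernel serves every index.\<close>
    have "(\<Sum>z\<in>V \<times> V. \<nu> z * W2 z * u i z)
        = (\<Sum>z\<in>V \<times> V. \<nu> z * cexp \<nu> (prod_partition P) W2 z * u i z)"
      using pairs.sum_cexp_const_on_parts[OF partition_on_prod_partition[OF P'] ui(1)] by simp
    also have "\<dots> = (\<Sum>z\<in>V \<times> V. \<nu> z * ?f z * u i z)"
      using stepk_eq_cexp[OF P'] by (intro sum.cong) auto
    also have "\<dots> = (\<Sum>z\<in>V \<times> V. \<nu> z * g z * u i z) + (\<Sum>z\<in>V \<times> V. \<nu> z * (?f z - g z) * u i z)"
      by (simp add: algebra_simps flip: sum.distrib)
    finally have eq: "(\<Sum>z\<in>V \<times> V. \<nu> z * W2 z * u i z) = \<dots>" .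
    have "\<bar>\<Sum>z\<in>V \<times> V. \<nu> z * (?f z - g z) * u i z\<bar> \<le> (\<Sum>z\<in>V \<times> V. \<bar>\<nu> z * (?f z - g z) * u i z\<bar>)"
      by (rule sum_abs)
    also have "\<dots> \<le> (\<Sum>z\<in>V \<times> V. \<nu> z * \<bar>?f z - g z\<bar>)"
    proof (rule sum_mono)
      fix z assume "z \<in> V \<times> V"
      then show "\<bar>\<nu> z * (?f z - g z) * u i z\<bar> \<le> \<nu> z * \<bar>?f z - g z\<bar>"
        using \<nu>0 ui(2) by (auto simp: abs_mult intro!: mult_left_le)
    qed
    finally have "e - 148 * \<kappa> - a \<le> \<bar>\<Sum>z\<in>V \<times> V. \<nu> z * g z * u i z\<bar>" using g(1) ui(3) eq by linarith
    from power_mono[OF this e, of 2] show ?thesis by simp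
  qed
  then have "(\<Sum>i<Suc K. (e - 148 * \<kappa> - a)\<^sup>2) \<le> (\<Sum>i<Suc K. (\<Sum>z\<in>V \<times> V. \<nu> z * g z * u i z)\<^sup>2)"
    by (intro sum_mono) blast
  also have "\<dots> \<le> (\<Sum>z\<in>V \<times> V. \<nu> z * (g z)\<^sup>2)"
  proof (rule pairs.bessel_inequality)
    show "(\<Sum>z\<in>V \<times> V. \<nu> z * u i z * u j z) = 0" if "i < Suc K" "j < Suc K" "i \<noteq> j" for i j
      using u that unfolding test_family_def by blast
    fix i assume "i < Suc K"
    then have "(u i z)\<^sup>2 \<le> 1" if "z \<in> V \<times> V" for z
      using u that unfolding test_family_def by (metis abs_square_le_1)
    then have "(\<Sum>z\<in>V \<times> V. \<nu> z * (u i z)\<^sup>2) \<le> (\<Sum>z\<in>V \<times> V. \<nu> z)"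
      using \<nu>0 by (intro sum_mono) (auto intro: mult_left_le)
    with total show "(\<Sum>z\<in>V \<times> V. \<nu> z * (u i z)\<^sup>2) \<le> 1" by simp
  qed
  finally show False using g(2) E by simp
qed

end

section \<open>Consequences of the Lp bound\<close>

text \<open>The tangent of \<open>y powr r\<close> at 1 lies below the curve; this is Young's
  inequality for the product of \<open>y\<close> and 1.\<close>

lemma bernoulli_powr:
  fixes y :: real
  assumes "y \<ge> 0" "r > 1"
  shows "1 + r * (y - 1) \<le> y powr r"
proof -
  have "y * 1 \<le> y powr r / r + 1 powr (r / (r - 1)) / (r / (r - 1))"
    using assms by (intro Youngs_inequality) (auto simp: field_simps)
  then have "r * y \<le> r * (y powr r / r + (r - 1) / r)"
    using assms by (intro mult_left_mono) auto
  also have "\<dots> = y powr r + (r - 1)"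
    using assms by (simp add: field_simps)
  finally have "y * r \<le> y powr r + (r - 1)" by (simp add: mult.commute)
  then show ?thesis by (simp add: algebra_simps)
qed

section \<open>Hoelder's inequality and truncation\<close>

context weighted_space
begin

definition Lp_le :: "ereal \<Rightarrow> real \<Rightarrow> ('b \<Rightarrow> real) \<Rightarrow> bool" where
  "Lp_le p C f \<longleftrightarrow> (if p = \<infinity> then \<forall>z\<in>\<Omega>. \<bar>f z\<bar> \<le> C
     else (\<Sum>z\<in>\<Omega>. \<nu> z * \<bar>f z\<bar> powr real_of_ereal p) \<le> C powr real_of_ereal p)"

lemma holder_subset:
  assumes p: "p > 1" and "C > 0" "\<delta> > 0" and f: "Lp_le p C f"
    and A: "A \<subseteq> \<Omega>" "sum \<nu> A \<le> \<delta>"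
  shows "(\<Sum>z\<in>A. \<nu> z * \<bar>f z\<bar>) \<le> C * \<delta> powr (1 / conj_exponent p)"
proof (cases "p = \<infinity>")
  case True
  have "(\<Sum>z\<in>A. \<nu> z * \<bar>f z\<bar>) \<le> (\<Sum>z\<in>A. \<nu> z * C)"
    using True f A weight_pos by (intro sum_mono mult_left_mono) (auto simp: Lp_le_def intro: less_imp_le)
  also have "\<dots> \<le> \<delta> * C" using A \<open>C > 0\<close> by (simp flip: sum_distrib_right)
  finally show ?thesis using True \<open>\<delta> > 0\<close> by (simp add: conj_exponent_def mult.commute)
next
  case False
  with p obtain r where r: "p = ereal r" "r > 1" by (cases p) auto
  \<comment> \<open>The extremal level: the constant \<open>K\<close> on a set of weight \<delta>
    has L^r norm exactly \<open>C\<close>. The bound \<open>pointwise\<close> is the tangent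
    inequality at this level, and summing it over \<open>A\<close> gives
    \<open>K * \<delta>\<close>.\<close>
  define K where "K = C * \<delta> powr (- 1 / r)"
  have K: "K > 0" using assms by (simp add: K_def)
  have CK: "C powr r / K powr r = \<delta>"
  proof -
    have "K powr r = C powr r * \<delta> powr (- 1)" using assms r by (simp add: K_def powr_mult powr_powr)
    then show ?thesis using assms by (simp add: powr_minus inverse_eq_divide)
  qed
  have nonneg: "0 \<le> \<nu> z" if "z \<in> \<Omega>" for z using weight_pos[OF that] by simp
  have pointwise: "\<bar>y\<bar> \<le> K / r * (\<bar>y\<bar> powr r / K powr r) + K * (1 - 1 / r)" for y
  proof -
    have "1 + r * (\<bar>y\<bar> / K - 1) \<le> (\<bar>y\<bar> / K) powr r" using K r by (intro bernoulli_powr) auto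
    then have "K / r * (1 + r * (\<bar>y\<bar> / K - 1)) \<le> K / r * (\<bar>y\<bar> powr r / K powr r)"
      using K r by (intro mult_left_mono) (auto simp: powr_divide)
    moreover have "K / r * (1 + r * (\<bar>y\<bar> / K - 1)) = \<bar>y\<bar> - K * (1 - 1 / r)"
      using K r by (simp add: field_simps)
    ultimately show ?thesis by simp
  qed
  have "(\<Sum>z\<in>A. \<nu> z * \<bar>f z\<bar>) \<le> (\<Sum>z\<in>A. \<nu> z * (K / r * (\<bar>f z\<bar> powr r / K powr r) + K * (1 - 1 / r)))"
    using A nonneg by (intro sum_mono mult_left_mono pointwise) auto
  also have "\<dots> = K / r / K powr r * (\<Sum>z\<in>A. \<nu> z * \<bar>f z\<bar> powr r) + K * (1 - 1 / r) * sum \<nu> A"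
    unfolding sum_distrib_left sum.distrib[symmetric]
    by (intro sum.cong refl) (simp add: distrib_left mult_ac)
  also have "\<dots> \<le> K / r / K powr r * C powr r + K * (1 - 1 / r) * \<delta>"
  proof (intro add_mono mult_left_mono)
    have "(\<Sum>z\<in>A. \<nu> z * \<bar>f z\<bar> powr r) \<le> (\<Sum>z\<in>\<Omega>. \<nu> z * \<bar>f z\<bar> powr r)"
      using A finite_space nonneg by (intro sum_mono2) auto
    also have "\<dots> \<le> C powr r" using f r by (simp add: Lp_le_def)
    finally show "(\<Sum>z\<in>A. \<nu> z * \<bar>f z\<bar> powr r) \<le> C powr r" .
  qed (use A K r in auto)
  also have "\<dots> = K / r * (C powr r / K powr r) + K * (1 - 1 / r) * \<delta>" by simp
  also have "\<dots> = K * \<delta>" unfolding CK using r by (simp add: field_simps)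
  also have "\<dots> = C * \<delta> powr (1 / conj_exponent p)"
  proof -
    have "1 / conj_exponent p = - 1 / r + 1" using r by (simp add: conj_exponent_def field_simps)
    then have "\<delta> powr (1 / conj_exponent p) = \<delta> powr (- 1 / r) * \<delta>"
      using \<open>\<delta> > 0\<close> by (simp only: powr_add) simp
    then show ?thesis by (simp add: K_def)
  qed
  finally show ?thesis .
qed

text \<open>For p at least 2 the choice \<open>g = f\<close> works, as the L^2 norm is at most the
  L^p norm on a probability space; for p below 2 large values are cut off. With
  \<open>L = 6 / \<epsilon>\<close> the second bound becomes
  \<open>N * (C * \<epsilon> / 6)\<^sup>2\<close>.\<close>

lemma Lp_truncation:
  assumes p: "p > 1" and "C > 0" "L \<ge> 1" and f: "Lp_le p C f" and total: "sum \<nu> \<Omega> = 1"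
  shows "\<exists>g. (\<Sum>z\<in>\<Omega>. \<nu> z * \<bar>f z - g z\<bar>) \<le> C / L \<and>
    (\<Sum>z\<in>\<Omega>. \<nu> z * (g z)\<^sup>2) \<le> C\<^sup>2 * L powr (max 2 (conj_exponent p) - 2)"
proof -
  have nonneg: "0 \<le> \<nu> z" if "z \<in> \<Omega>" for z using weight_pos[OF that] by simp
  have trivial: ?thesis if "(\<Sum>z\<in>\<Omega>. \<nu> z * (f z)\<^sup>2) \<le> C\<^sup>2"
  proof -
    have "C\<^sup>2 * 1 \<le> C\<^sup>2 * L powr (max 2 (conj_exponent p) - 2)"
      using \<open>L \<ge> 1\<close> by (intro mult_left_mono ge_one_powr_ge_zero) auto
    then have "C\<^sup>2 \<le> C\<^sup>2 * L powr (max 2 (conj_exponent p) - 2)" by (simp only: mult_1_right)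
    from order_trans[OF that this] show ?thesis
      using \<open>C > 0\<close> \<open>L \<ge> 1\<close> by (intro exI[of _ f] conjI) auto
  qed
  consider "p = \<infinity>" | r where "p = ereal r" "r \<ge> 2" | r where "p = ereal r" "r > 1" "r < 2"
    using p by (cases p) (auto simp: not_le intro: leI)
  then show ?thesis
  proof cases
    case 1
    have "(f z)\<^sup>2 \<le> C\<^sup>2" if "z \<in> \<Omega>" for z
      using f 1 that \<open>C > 0\<close> by (intro abs_le_square_iff[THEN iffD1]) (auto simp: Lp_le_def)
    then have "(\<Sum>z\<in>\<Omega>. \<nu> z * (f z)\<^sup>2) \<le> (\<Sum>z\<in>\<Omega>. \<nu> z * C\<^sup>2)"
      using nonneg by (intro sum_mono mult_left_mono) auto
    also have "\<dots> = C\<^sup>2" using total by (simp flip: sum_distrib_right)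
    finally show ?thesis by (rule trivial)
  next
    case (2 r)
    \<comment> \<open>The tangent inequality for the square of \<open>y / C\<close> with exponent
      \<open>r/2\<close>; summing it is Jensen's inequality. For \<open>r = 2\<close> the exponent
      is 1, outside the range of \<open>bernoulli_powr\<close>, and equality holds.\<close>
    have pointwise: "1 + r/2 * ((y / C)\<^sup>2 - 1) \<le> \<bar>y\<bar> powr r / C powr r" for y
    proof (cases "r = 2 \<or> y = 0")
      case True
      then show ?thesis using 2 \<open>C > 0\<close> by (auto simp: power_divide diff_divide_distrib)
    next
      case False
      have "\<bar>y\<bar> powr r / C powr r = ((\<bar>y\<bar> / C) powr 2) powr (r/2)"
        using \<open>C > 0\<close> by (simp only: powr_powr) (simp add: powr_divide)
      also have "(\<bar>y\<bar> / C) powr 2 = (y / C)\<^sup>2"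
        using \<open>C > 0\<close> False by (simp add: power_divide)
      finally show ?thesis using bernoulli_powr[of "(y / C)\<^sup>2" "r/2"] 2 False by simp
    qed
    have "(\<Sum>z\<in>\<Omega>. \<nu> z * (1 + r/2 * ((f z / C)\<^sup>2 - 1)))
        = (1 - r/2) * sum \<nu> \<Omega> + r/2 / C\<^sup>2 * (\<Sum>z\<in>\<Omega>. \<nu> z * (f z)\<^sup>2)"
      unfolding sum_distrib_left sum.distrib[symmetric]
      by (intro sum.cong refl) (simp add: algebra_simps power_divide)
    then have "1 + r/2 * ((\<Sum>z\<in>\<Omega>. \<nu> z * (f z)\<^sup>2) / C\<^sup>2 - 1)
        = (\<Sum>z\<in>\<Omega>. \<nu> z * (1 + r/2 * ((f z / C)\<^sup>2 - 1)))"
      using total by (simp add: algebra_simps)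
    also have "\<dots> \<le> (\<Sum>z\<in>\<Omega>. \<nu> z * (\<bar>f z\<bar> powr r / C powr r))"
      using nonneg by (intro sum_mono mult_left_mono pointwise) auto
    also have "\<dots> = (\<Sum>z\<in>\<Omega>. \<nu> z * \<bar>f z\<bar> powr r) / C powr r" by (simp add: sum_divide_distrib)
    also have "\<dots> \<le> 1" using f 2 \<open>C > 0\<close> by (simp add: Lp_le_def)
    finally have "(\<Sum>z\<in>\<Omega>. \<nu> z * (f z)\<^sup>2) / C\<^sup>2 \<le> 1" using 2 by (simp add: mult_le_0_iff)
    then show ?thesis using \<open>C > 0\<close> by (intro trivial) simp
  next
    case (3 r)
    \<comment> \<open>The cut-off level solves \<open>C powr r * K powr (1 - r) = C / L\<close>,
      whose left side bounds the mass above the level. In the square bound,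
      \<open>(2 - r) / (r - 1)\<close> is the conjugate exponent minus 2.\<close>
    define K where "K = C * L powr (1 / (r - 1))"
    have K: "K > 0" using \<open>C > 0\<close> \<open>L \<ge> 1\<close> by (simp add: K_def)
    define g where "g z = (if \<bar>f z\<bar> \<le> K then f z else 0)" for z
    have fr: "(\<Sum>z\<in>\<Omega>. \<nu> z * \<bar>f z\<bar> powr r) \<le> C powr r" using f 3 by (simp add: Lp_le_def)
    have diff: "\<bar>f z - g z\<bar> \<le> \<bar>f z\<bar> powr r * K powr (1 - r)" for z
    proof (cases "\<bar>f z\<bar> \<le> K")
      case False
      then have "\<bar>f z\<bar> powr (1 - r) \<le> K powr (1 - r)" using K 3 by (intro powr_mono2') auto
      then have "\<bar>f z\<bar> powr r * \<bar>f z\<bar> powr (1 - r) \<le> \<bar>f z\<bar> powr r * K powr (1 - r)"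
        by (intro mult_left_mono) auto
      then show ?thesis using False K by (simp add: g_def flip: powr_add)
    qed (simp add: g_def)
    have sq: "(g z)\<^sup>2 \<le> \<bar>f z\<bar> powr r * K powr (2 - r)" for z
    proof (cases "\<bar>f z\<bar> \<le> K \<and> f z \<noteq> 0")
      case True
      then have "\<bar>f z\<bar> powr (2 - r) \<le> K powr (2 - r)" using 3 by (intro powr_mono2) auto
      then have "\<bar>f z\<bar> powr r * \<bar>f z\<bar> powr (2 - r) \<le> \<bar>f z\<bar> powr r * K powr (2 - r)"
        by (intro mult_left_mono) auto
      then show ?thesis using True by (simp add: g_def flip: powr_add)
    qed (auto simp: g_def)
    have "(\<Sum>z\<in>\<Omega>. \<nu> z * \<bar>f z - g z\<bar>) \<le> (\<Sum>z\<in>\<Omega>. \<nu> z * (\<bar>f z\<bar> powr r * K powr (1 - r)))"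
      using nonneg by (intro sum_mono mult_left_mono diff) auto
    also have "\<dots> = (\<Sum>z\<in>\<Omega>. \<nu> z * \<bar>f z\<bar> powr r) * K powr (1 - r)"
      by (simp add: sum_distrib_right mult.assoc)
    also have "\<dots> \<le> C powr r * K powr (1 - r)" using fr by (intro mult_right_mono) auto
    also have "\<dots> = C powr 1 * L powr (- 1)"
    proof -
      have "1 / (r - 1) * (1 - r) = - 1" using 3 by (simp add: field_simps)
      then have "K powr (1 - r) = C powr (1 - r) * L powr (- 1)"
        using \<open>C > 0\<close> \<open>L \<ge> 1\<close> by (simp add: K_def powr_mult powr_powr)
      then show ?thesis by (simp flip: powr_add mult.assoc)
    qed
    also have "\<dots> = C / L" using \<open>C > 0\<close> \<open>L \<ge> 1\<close> by (simp add: powr_minus divide_inverse)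
    finally have d: "(\<Sum>z\<in>\<Omega>. \<nu> z * \<bar>f z - g z\<bar>) \<le> C / L" .
    have "(\<Sum>z\<in>\<Omega>. \<nu> z * (g z)\<^sup>2) \<le> (\<Sum>z\<in>\<Omega>. \<nu> z * (\<bar>f z\<bar> powr r * K powr (2 - r)))"
      using nonneg by (intro sum_mono mult_left_mono sq) auto
    also have "\<dots> = (\<Sum>z\<in>\<Omega>. \<nu> z * \<bar>f z\<bar> powr r) * K powr (2 - r)"
      by (simp add: sum_distrib_right mult.assoc)
    also have "\<dots> \<le> C powr r * K powr (2 - r)" using fr by (intro mult_right_mono) auto
    also have "\<dots> = C powr 2 * L powr (max 2 (conj_exponent p) - 2)"
    proof -
      have "conj_exponent p \<ge> 2" using 3 by (simp add: conj_exponent_def field_simps)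
      moreover have "1 / (r - 1) * (2 - r) = conj_exponent p - 2"
        using 3 by (simp add: conj_exponent_def field_simps)
      ultimately have "K powr (2 - r) = C powr (2 - r) * L powr (max 2 (conj_exponent p) - 2)"
        using \<open>C > 0\<close> \<open>L \<ge> 1\<close> by (simp add: K_def powr_mult powr_powr)
      then show ?thesis by (simp flip: powr_add mult.assoc)
    qed
    finally show ?thesis using d \<open>C > 0\<close> by auto
  qed
qed

end

section \<open>Weighted graphs\<close>

text \<open>The factors \<open>total_weight G\<close> of the normalised weights cancel, so
  \<open>stepk\<close> is the edge weight of \<open>step_graph\<close> divided by
  \<open>norm1 G\<close>.\<close>

lemma stepk_eq_rho:
  assumes "total_weight G > 0"
  shows "stepk (\<lambda>x. vweight G x / total_weight G) P (\<lambda>x y. eweight G x y / norm1 G) s t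
    = rho G (part_of P s) (part_of P t) / norm1 G"
proof -
  let ?\<alpha> = "total_weight G" and ?A = "part_of P s" and ?B = "part_of P t"
  let ?k = "\<Sum>s\<in>?A. \<Sum>t\<in>?B. vweight G s * vweight G t * eweight G s t"
  have "kint (\<lambda>x. vweight G x / ?\<alpha>) (\<lambda>x y. eweight G x y / norm1 G) ?A ?B
      = ?k / (?\<alpha>\<^sup>2 * norm1 G)"
    by (simp add: kint_def sum_divide_distrib power2_eq_square mult.assoc)
  moreover have "rho G ?A ?B = ?k / (set_weight G ?A * set_weight G ?B)"
    by (simp add: rho_def sum_divide_distrib)
  moreover have "(\<Sum>x\<in>A. vweight G x / ?\<alpha>) = set_weight G A / ?\<alpha>" for A
    by (simp add: set_weight_def sum_divide_distrib)
  ultimately show ?thesis using assms by (simp add: stepk_def power2_eq_square)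
qed

lemma cut_dist_leI:
  assumes "finite (verts G)"
    and "\<And>S T. S \<subseteq> verts G \<Longrightarrow> T \<subseteq> verts G \<Longrightarrow>
      \<bar>\<Sum>s\<in>S. \<Sum>t\<in>T. vweight G s * vweight G t / (total_weight G)\<^sup>2 *
         (eweight G s t - eweight G' s t)\<bar> \<le> c"
  shows "cut_dist G G' \<le> c"
proof -
  let ?F = "\<lambda>(S, T). \<bar>\<Sum>s\<in>S. \<Sum>t\<in>T. vweight G s * vweight G t / (total_weight G)\<^sup>2 *
         (eweight G s t - eweight G' s t)\<bar>"
  have eq: "{\<bar>\<Sum>s\<in>S. \<Sum>t\<in>T. vweight G s * vweight G t / (total_weight G)\<^sup>2 *
      (eweight G s t - eweight G' s t)\<bar> | S T. S \<subseteq> verts G \<and> T \<subseteq> verts G}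
      = ?F ` (Pow (verts G) \<times> Pow (verts G))" by auto
  show ?thesis unfolding cut_dist_def eq
    using assms by (subst Max_le_iff) auto
qed

text \<open>The averaged kernel is constant on products of parts, so its L^p sum over pairs of
  vertices collapses to the sum over pairs of parts in \<open>upper_Lp_regular\<close>.\<close>

lemma upper_Lp_regular_stepk:
  assumes G: "weighted_graph G" "norm1 G \<noteq> 0" "upper_Lp_regular p C \<eta> G"
    and pos: "total_weight G > 0"
    and P: "partition_on (verts G) P" "\<forall>A\<in>P. \<eta> \<le> (\<Sum>x\<in>A. vweight G x / total_weight G)"
  defines "\<mu> \<equiv> \<lambda>x. vweight G x / total_weight G"
  shows "weighted_space.Lp_le (verts G \<times> verts G) (pair_weight \<mu>) p C
    (\<lambda>z. stepk \<mu> P (\<lambda>x y. eweight G x y / norm1 G) (fst z) (snd z))"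
proof -
  let ?V = "verts G" and ?\<alpha> = "total_weight G"
  let ?f = "\<lambda>s t. stepk \<mu> P (\<lambda>x y. eweight G x y / norm1 G) s t"
  have fin: "finite ?V" and vpos: "\<And>x. x \<in> ?V \<Longrightarrow> vweight G x > 0"
    using G(1) by (auto simp: weighted_graph_def)
  interpret weighted_space "?V \<times> ?V" "pair_weight \<mu>"
    using fin vpos pos by unfold_locales (auto simp: pair_weight_def \<mu>_def)
  have finP: "finite P" using finite_elements[OF fin P(1)] .
  have f: "?f s t = rho G (part_of P s) (part_of P t) / norm1 G" for s t
    unfolding \<mu>_def by (rule stepk_eq_rho[OF pos])
  have n: "norm1 G > 0"
  proof -
    have "norm1 G \<ge> 0" unfolding norm1_def
      using vpos by (intro sum_nonneg mult_nonneg_nonneg divide_nonneg_nonneg) (auto intro: less_imp_le)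
    with G(2) show ?thesis by simp
  qed
  have w: "(\<Sum>x\<in>A. \<mu> x) = set_weight G A / ?\<alpha>" for A
    by (simp add: \<mu>_def set_weight_def sum_divide_distrib)
  have "\<forall>A\<in>P. set_weight G A \<ge> \<eta> * ?\<alpha>"
    using P(2) pos w by (simp add: \<mu>_def pos_le_divide_eq)
  with G(3) P(1) have reg: "if p = \<infinity> then Max {\<bar>rho G A B\<bar> / norm1 G | A B. A \<in> P \<and> B \<in> P} \<le> C
         else (\<Sum>A\<in>P. \<Sum>B\<in>P. set_weight G A * set_weight G B / ?\<alpha>\<^sup>2 *
                 \<bar>rho G A B / norm1 G\<bar> powr real_of_ereal p) \<le> C powr real_of_ereal p"
    unfolding upper_Lp_regular_def by blast
  show ?thesis
  proof (cases "p = \<infinity>")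
    case True
    have "\<bar>?f s t\<bar> \<le> C" if "s \<in> ?V" "t \<in> ?V" for s t
    proof -
      have "{\<bar>rho G A B\<bar> / norm1 G | A B. A \<in> P \<and> B \<in> P}
          = (\<lambda>(A, B). \<bar>rho G A B\<bar> / norm1 G) ` (P \<times> P)" by auto
      then have "\<bar>rho G (part_of P s) (part_of P t)\<bar> / norm1 G
          \<le> Max {\<bar>rho G A B\<bar> / norm1 G | A B. A \<in> P \<and> B \<in> P}"
        using finP part_of_props(1)[OF P(1)] that by (intro Max_ge) auto
      with reg True n show ?thesis by (simp add: f)
    qed
    with True show ?thesis by (simp add: Lp_le_def)
  next
    case False
    let ?h = "\<lambda>A B. \<bar>rho G A B / norm1 G\<bar> powr real_of_ereal p"
    have "(\<Sum>z\<in>?V \<times> ?V. pair_weight \<mu> z * \<bar>?f (fst z) (snd z)\<bar> powr real_of_ereal p)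
        = (\<Sum>s\<in>?V. \<mu> s * (\<Sum>t\<in>?V. \<mu> t * ?h (part_of P s) (part_of P t)))"
      by (simp add: sum_pair_weight f sum_distrib_left mult.assoc)
    also have "\<dots> = (\<Sum>A\<in>P. sum \<mu> A * (\<Sum>B\<in>P. sum \<mu> B * ?h A B))"
      by (simp only: sum_part_of[OF fin P(1), of \<mu> "?h _"]
        sum_part_of[OF fin P(1), of \<mu> "\<lambda>A. \<Sum>B\<in>P. sum \<mu> B * ?h A B"])
    also have "\<dots> = (\<Sum>A\<in>P. \<Sum>B\<in>P. set_weight G A * set_weight G B / ?\<alpha>\<^sup>2 * ?h A B)"
      by (simp add: w sum_distrib_left power2_eq_square mult_ac)
    finally show ?thesis using reg False by (simp add: Lp_le_def)
  qed
qed

theorem theorem4p5: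
  fixes G :: "'a wgraph" and p :: ereal and C \<epsilon> N \<eta> :: real
  assumes "C > 0" and "p > 1" and "0 < \<epsilon>" and "\<epsilon> < 1"
    and "N = (6 / \<epsilon>) powr max 2 (conj_exponent p)"
    and "\<eta> = 4 powr (- N - 1) * (\<epsilon> / 320) powr conj_exponent p"
    and "weighted_graph G" and "norm1 G \<noteq> 0"
    and "upper_Lp_regular p C \<eta> G"
  shows "\<exists>P. partition_on (verts G) P \<and> real (card P) \<le> 4 powr N \<and>
           (\<forall>A\<in>P. set_weight G A \<ge> \<eta> * total_weight G) \<and>
           cut_dist (scale_graph (1 / norm1 G) G) (scale_graph (1 / norm1 G) (step_graph G P))
             \<le> C * \<epsilon>"
proof -
  let ?V = "verts G" and ?\<alpha> = "total_weight G"
  define q where "q = conj_exponent p"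
  \<comment> \<open>Chosen so that Hoelder's inequality on a rectangle of weight \<delta> gives
    \<open>C * \<delta> powr (1 / q) = \<kappa>\<close>.\<close>
  define \<delta> where "\<delta> = (\<epsilon> / 320) powr q"
  define \<kappa> where "\<kappa> = C * (\<epsilon> / 320)"
  define \<mu> where "\<mu> = (\<lambda>x. vweight G x / ?\<alpha>)"
  define W where "W = (\<lambda>x y. eweight G x y / norm1 G)"
  have fin: "finite ?V" and vpos: "\<And>x. x \<in> ?V \<Longrightarrow> vweight G x > 0"
    and sym: "\<And>x y. x \<in> ?V \<Longrightarrow> y \<in> ?V \<Longrightarrow> eweight G x y = eweight G y x"
    using assms(7) by (auto simp: weighted_graph_def)
  have "?V \<noteq> {}" using assms(8) by (auto simp: norm1_def)
  then have pos: "?\<alpha> > 0" unfolding total_weight_def set_weight_def using fin vpos by (intro sum_pos) auto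
  have q: "q \<ge> 1" using assms(2) by (cases p) (auto simp: q_def conj_exponent_def)
  have L: "6 < 6 / \<epsilon>" using assms(3,4) by (simp add: field_simps)
  have N36: "36 \<le> N"
  proof -
    have "(6 / \<epsilon>) powr 2 \<le> N" unfolding assms(5) using L by (intro powr_mono) auto
    moreover have "(6::real) powr 2 \<le> (6 / \<epsilon>) powr 2" using L by (intro powr_mono2) auto
    ultimately show ?thesis by simp
  qed
  have \<delta>pos: "\<delta> > 0" using assms(3) by (simp add: \<delta>_def)
  have \<delta>q: "\<delta> powr (1 / q) = \<epsilon> / 320" using assms(3) q by (simp add: \<delta>_def powr_powr)
  have \<delta>le: "\<delta> \<le> 1/8"
  proof -
    have "\<delta> \<le> (\<epsilon> / 320) powr 1" unfolding \<delta>_def using q assms(3,4) by (intro powr_mono') auto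
    then show ?thesis using assms(3,4) by simp
  qed
  have \<eta>: "\<eta> = 4 powr (- N - 1) * \<delta>" using assms(6) by (simp add: \<delta>_def q_def)
  \<comment> \<open>This explains the power of 4 in \<eta>: rounding a partition with at most
    \<open>4 powr N\<close> parts moves weight at most
    \<open>3 * \<eta> * 4 powr N = 3/4 * \<delta>\<close>.\<close>
  have \<eta>N: "4 * \<eta> * 4 powr N = \<delta>"
  proof -
    have "4 powr (- N - 1) = 1 / (4 * 4 powr N)"
      by (simp add: powr_diff powr_minus field_simps)
    then show ?thesis by (simp add: \<eta>)
  qed
  have \<eta>pos: "\<eta> > 0" using \<delta>pos by (simp add: \<eta>)
  have \<eta>\<delta>: "8 * \<eta> \<le> \<delta>"
  proof -
    have "(4::real) powr 1 \<le> 4 powr N" using N36 by (intro powr_mono) auto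
    then have "4 * \<eta> * 4 \<le> 4 * \<eta> * 4 powr N" using \<eta>pos by (intro mult_left_mono) auto
    then show ?thesis using \<eta>N \<eta>pos by simp
  qed
  have total: "sum \<mu> ?V = 1"
    using pos by (simp add: \<mu>_def total_weight_def set_weight_def flip: sum_divide_distrib)
  have \<mu>pos: "\<And>x. x \<in> ?V \<Longrightarrow> \<mu> x > 0" using vpos pos by (simp add: \<mu>_def)

  \<comment> \<open>The normalised graph as a regular kernel\<close>
  interpret pairs: weighted_space "?V \<times> ?V" "pair_weight \<mu>"
    using fin \<mu>pos by unfold_locales (auto simp: pair_weight_def)
  have pair_rect: "sum (pair_weight \<mu>) (U \<times> X) = sum \<mu> U * sum \<mu> X" for U X
    using sum_pair_weight[of \<mu> "\<lambda>_. 1" U X] by (simp add: sum_product)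
  have Lp: "pairs.Lp_le p C (\<lambda>z. stepk \<mu> P W (fst z) (snd z))"
    if "partition_on ?V P" "\<forall>A\<in>P. \<eta> \<le> sum \<mu> A" for P
    using upper_Lp_regular_stepk[OF assms(7-9) pos that(1)] that(2) by (simp add: \<mu>_def W_def)
  interpret regular_kernel ?V \<mu> W \<eta> \<delta> \<kappa>
  proof
    show "\<mu> x \<le> \<eta>" if "x \<in> ?V" for x
      using assms(9) that pos by (auto simp: upper_Lp_regular_def \<mu>_def pos_divide_le_eq)
    show "W x y = W y x" if "x \<in> ?V" "y \<in> ?V" for x y using sym that by (simp add: W_def)
    fix P U X
    assume P: "partition_on ?V P" "\<forall>A\<in>P. \<eta> \<le> sum \<mu> A" and UX: "U \<subseteq> ?V" "X \<subseteq> ?V"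
      "sum \<mu> U * sum \<mu> X \<le> \<delta>"
    let ?f = "\<lambda>z. stepk \<mu> P W (fst z) (snd z)"
    have "\<bar>kint \<mu> (stepk \<mu> P W) U X\<bar> = \<bar>\<Sum>z\<in>U \<times> X. pair_weight \<mu> z * ?f z\<bar>"
      by (simp add: kint_def sum_pair_weight)
    also have "\<dots> \<le> (\<Sum>z\<in>U \<times> X. \<bar>pair_weight \<mu> z * ?f z\<bar>)" by (rule sum_abs)
    also have "\<dots> = (\<Sum>z\<in>U \<times> X. pair_weight \<mu> z * \<bar>?f z\<bar>)"
    proof (rule sum.cong)
      fix z assume "z \<in> U \<times> X"
      then have "z \<in> ?V \<times> ?V" using UX by auto
      from pairs.weight_pos[OF this] show "\<bar>pair_weight \<mu> z * ?f z\<bar> = pair_weight \<mu> z * \<bar>?f z\<bar>"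
        by (simp add: abs_mult)
    qed simp
    also have "\<dots> \<le> C * \<delta> powr (1 / conj_exponent p)"
      using UX by (intro pairs.holder_subset assms \<delta>pos Lp P) (auto simp: pair_rect)
    also have "\<dots> = \<kappa>" using \<delta>q by (simp add: \<kappa>_def q_def)
    finally show "\<bar>kint \<mu> (stepk \<mu> P W) U X\<bar> \<le> \<kappa>" .
  qed (use fin \<mu>pos total \<eta>pos \<eta>\<delta> \<delta>le in auto)
  \<comment> \<open>Rounding down keeps \<open>4 ^ K\<close> within the allowed number of parts,
    while \<open>Suc K\<close> exceeds \<open>N\<close> strictly, as the contradiction with Bessel's
    inequality requires.\<close>
  define K where "K = nat \<lfloor>N\<rfloor>"
  have K: "real K \<le> N" "N < real (Suc K)" using N36 by (auto simp: K_def) linarith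
  have K4: "4 ^ K \<le> 4 powr N"
    using K(1) powr_mono[of "real K" N 4] by (simp add: powr_realpow)
  define E where "E = C\<^sup>2 * (6 / \<epsilon>) powr (max 2 q - 2)"
  have EN: "E = N * (C * \<epsilon> / 6)\<^sup>2"
  proof -
    have "(6 / \<epsilon>) powr (max 2 q - 2) = N / (6 / \<epsilon>) powr 2"
      by (simp add: assms(5) q_def powr_diff)
    also have "(6 / \<epsilon>) powr 2 = (6 / \<epsilon>)\<^sup>2" using assms(3) by simp
    finally show ?thesis using assms(3) by (simp add: E_def field_simps power2_eq_square)
  qed
  define e where "e = C * \<epsilon>"
  have e: "e > 0" using assms by (simp add: e_def)
  \<comment> \<open>Rounding loses \<open>148/320 * e\<close>, less than half of \<open>e\<close>,
    and truncation loses \<open>e / 6\<close>, so more than \<open>e / 3\<close> remains.\<close>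
  have gap: "e / 6 \<le> e - 148 * \<kappa> - C / (6 / \<epsilon>)" using e by (simp add: \<kappa>_def e_def)
  have "\<exists>P. admissible P \<and> card P \<le> 4 ^ K \<and>
    (\<forall>S\<subseteq>?V. \<forall>T\<subseteq>?V. \<bar>kint \<mu> W S T - kint \<mu> (stepk \<mu> P W) S T\<bar> \<le> e)"
  proof (rule weak_regularity[where a = "C / (6 / \<epsilon>)" and E = E])
    have "4 * \<eta> * 4 ^ K \<le> 4 * \<eta> * 4 powr N" using K4 \<eta>pos by (intro mult_left_mono) auto
    then show "4 * \<eta> * 4 ^ K \<le> \<delta>" using \<eta>N by simp
    fix P assume "admissible P"
    then have "pairs.Lp_le p C (\<lambda>z. stepk \<mu> P W (fst z) (snd z))" by (simp add: Lp admissible_def)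
    moreover have "sum (pair_weight \<mu>) (?V \<times> ?V) = 1" using total by (simp add: pair_rect)
    ultimately show "\<exists>g. (\<Sum>z\<in>?V \<times> ?V. pair_weight \<mu> z * \<bar>stepk \<mu> P W (fst z) (snd z) - g z\<bar>)
        \<le> C / (6 / \<epsilon>) \<and> (\<Sum>z\<in>?V \<times> ?V. pair_weight \<mu> z * (g z)\<^sup>2) \<le> E"
      unfolding E_def q_def using assms(1,2) L by (intro pairs.Lp_truncation) auto
  next
    show "0 \<le> e - 148 * \<kappa> - C / (6 / \<epsilon>)" using gap e by simp
    have "E = N * (e / 6)\<^sup>2" by (simp add: EN e_def)
    also have "\<dots> < real (Suc K) * (e / 6)\<^sup>2" using K e by (intro mult_strict_right_mono) auto
    also have "\<dots> \<le> real (Suc K) * (e - 148 * \<kappa> - C / (6 / \<epsilon>))\<^sup>2"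
      using gap e by (intro mult_left_mono power_mono) auto
    finally show "E < real (Suc K) * (e - 148 * \<kappa> - C / (6 / \<epsilon>))\<^sup>2" .
  qed
  then obtain P where P: "partition_on ?V P" "\<forall>A\<in>P. \<eta> \<le> sum \<mu> A" "card P \<le> 4 ^ K"
    and cut: "\<And>S T. S \<subseteq> ?V \<Longrightarrow> T \<subseteq> ?V \<Longrightarrow> \<bar>kint \<mu> W S T - kint \<mu> (stepk \<mu> P W) S T\<bar> \<le> e"
    unfolding admissible_def by metis

  \<comment> \<open>Translation back to the graph and the cut distance\<close>
  have "real (card P) \<le> 4 powr N"
    using P(3) K4 by (meson numeral_power_le_of_nat_cancel_iff of_nat_le_numeral_power_cancel_iff order_trans)
  moreover have "\<forall>A\<in>P. set_weight G A \<ge> \<eta> * ?\<alpha>"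
    using P(2) pos by (simp add: \<mu>_def set_weight_def pos_le_divide_eq flip: sum_divide_distrib)
  moreover have "cut_dist (scale_graph (1 / norm1 G) G) (scale_graph (1 / norm1 G) (step_graph G P)) \<le> e"
  proof (rule cut_dist_leI)
    let ?G = "scale_graph (1 / norm1 G) G" and ?H = "scale_graph (1 / norm1 G) (step_graph G P)"
    have G': "verts ?G = ?V" "vweight ?G = vweight G" "total_weight ?G = ?\<alpha>"
      by (simp_all add: scale_graph_def total_weight_def set_weight_def)
    show "finite (verts ?G)" using fin by (simp add: G')
    fix S T assume ST: "S \<subseteq> verts ?G" "T \<subseteq> verts ?G"
    have W: "eweight ?G s t = W s t" "eweight ?H s t = stepk \<mu> P W s t" for s t
      using stepk_eq_rho[OF pos, of P s t]
      by (simp_all add: scale_graph_def step_graph_def W_def \<mu>_def)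
    have "(\<Sum>s\<in>S. \<Sum>t\<in>T. vweight ?G s * vweight ?G t / (total_weight ?G)\<^sup>2 *
        (eweight ?G s t - eweight ?H s t)) = kint \<mu> W S T - kint \<mu> (stepk \<mu> P W) S T"
      unfolding G' W kint_def sum_subtractf[symmetric]
      by (intro sum.cong refl) (simp add: \<mu>_def power2_eq_square right_diff_distrib)
    with cut ST show "\<bar>\<Sum>s\<in>S. \<Sum>t\<in>T. vweight ?G s * vweight ?G t / (total_weight ?G)\<^sup>2 *
        (eweight ?G s t - eweight ?H s t)\<bar> \<le> e" by (simp add: G')
  qed
  ultimately show ?thesis using P(1) unfolding e_def by blast
qed

end
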